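(* Let $n\ge 1$, let $\Sigma_0=\mathbb{S}^n(1/\sqrt{2})\times\mathbb{S}^n(1/\sqrt{2})$ be the minimal Clifford torus of the unit sphere $\mathbb{S}^{2n+1}\subset\mathbb{R}^{2n+2}$, and let $\widehat\Sigma_0=\{rp\,;\,r\in(0,+\infty),\ p\in\Sigma_0\}\subset\mathbb{R}^{2n+2}$ be the cone over $\Sigma_0$. Let $\boldsymbol{J}=\begin{pmatrix}0&-\mathrm{Id}\\ \mathrm{Id}&0\end{pmatrix}$ be the $(2n+2)\times(2n+2)$ block matrix, where $\mathrm{Id}$ is the identity matrix of order $n+1$. Then, for any $a,k>0$, the $a$-pitched twisting $$\widehat\Sigma(a,k):=\{(e^{(ks)\boldsymbol{J}}p,as)\,;\,p\in\widehat\Sigma_0,\ s\in\mathbb{R}\}\subset\mathbb{R}^{2n+2}\times\mathbb{R}$$ is an embedded vertical helicoid of $\mathbb{R}^{2n+2}\times\mathbb{R}$. Furthermore, for any fixed $a>0$, the parameter $k$ can be chosen in such a way that $\widehat\Sigma(a,k)$ contains open spacelike zero mean isocurved subsets.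
   Context: For a Riemannian manifold $M$, $M\times\mathbb{R}$ carries the product metric $\langle\,,\rangle=\langle\,,\rangle_M+dt^2$ with Levi-Civita connection $\overline\nabla$; $\partial_t$ is the unit vertical field. For an orientable hypersurface $\Sigma\subset M\times\mathbb{R}$ with unit normal $N$: the shape operator is $AX=-\overline\nabla_XN$; the mean curvature is $H=\mathrm{trace}\,A$ (not normalized); $\xi$ is the restriction to $\Sigma$ of the projection onto $\mathbb{R}$, with gradient $\nabla\xi$ on $\Sigma$; $\Theta=\langle N,\partial_t\rangle$ is the angle function. A horizontal point is a point where $\Theta^2=1$ (a critical point of $\xi$). A horizontal section of $\Sigma$ is $\Sigma_t=\Sigma\cap(M\times\{t\})$ when the intersection is transversal. Vertical helicoid: a hypersurface with no horizontal points and nonconstant angle function whose horizontal sections $\Sigma_t$ are minimal hypersurfaces of $M\times\{t\}$ and such that $\langle A\nabla\xi,\nabla\xi\rangle=0$ on $\Sigma$. Lorentzian notions: $\langle\,,\rangle_L=\langle\,,\rangle_M-dt^2$. $\Sigma$ is spacelike if $\langle\,,\rangle_L$ is positive definite on $\Sigma$ (equivalently $2\Theta^2>1$). For spacelike $\Sigma$, put $N_L=\mu\,(N-2\Theta\partial_t)$ with $\mu=-1/\sqrt{2\Theta^2-1}$ (so $\langle N_L,N_L\rangle_L=-1$), $A_LX=-\overline\nabla_XN_L$, $H_L=-\mathrm{trace}\,A_L$. A spacelike $\Sigma$ is zero mean isocurved if $H=H_L=0$. *)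

theory Defs
  imports "HOL-Analysis.Analysis"
begin

section \<open>Smooth maps\<close>

text \<open>
  Meant for open sets. As the domains are finite-dimensional, continuity of all iterated
  directional derivatives is the usual class \<open>C\<^sup>k\<close>.
\<close>

primrec Ck_on :: "nat \<Rightarrow> 'a::euclidean_space set \<Rightarrow> ('a \<Rightarrow> 'b::euclidean_space) \<Rightarrow> bool" where
  "Ck_on 0 U f \<longleftrightarrow> continuous_on U f"
| "Ck_on (Suc k) U f \<longleftrightarrow>
     (\<forall>x\<in>U. f differentiable (at x)) \<and>
     (\<forall>v. Ck_on k U (\<lambda>x. frechet_derivative f (at x) v))"

definition smooth_on :: "'a::euclidean_space set \<Rightarrow> ('a \<Rightarrow> 'b::euclidean_space) \<Rightarrow> bool" where
  "smooth_on U f \<longleftrightarrow> (\<forall>k. Ck_on k U f)"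

text \<open>Smoothness on an arbitrary subset: local smooth extendability.\<close>

definition smooth_on_subset :: "'a::euclidean_space set \<Rightarrow> ('a \<Rightarrow> 'b::euclidean_space) \<Rightarrow> bool" where
  "smooth_on_subset S f \<longleftrightarrow>
     (\<forall>p\<in>S. \<exists>U F. open U \<and> p \<in> U \<and> smooth_on U F \<and> (\<forall>x\<in>S \<inter> U. F x = f x))"


section \<open>Hypersurfaces of Euclidean space\<close>

text \<open>Embedded hypersurfaces: locally regular level sets.\<close>

definition embedded_hypersurface :: "'a::euclidean_space set \<Rightarrow> bool" where
  "embedded_hypersurface S \<longleftrightarrow>
     (\<forall>p\<in>S. \<exists>U (g :: 'a \<Rightarrow> real). open U \<and> p \<in> U \<and> smooth_on U g \<and>
        S \<inter> U = {x \<in> U. g x = 0} \<and>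
        (\<forall>x\<in>S \<inter> U. frechet_derivative g (at x) \<noteq> (\<lambda>_. 0)))"

definition tangent_space :: "'a::euclidean_space set \<Rightarrow> 'a \<Rightarrow> 'a set" where
  "tangent_space S p =
     {v. \<exists>(\<gamma> :: real \<Rightarrow> 'a) e. e > 0 \<and> smooth_on {-e<..<e} \<gamma> \<and> \<gamma> ` {-e<..<e} \<subseteq> S \<and>
         \<gamma> 0 = p \<and> (\<gamma> has_vector_derivative v) (at 0)}"

definition unit_normal_field :: "'a::euclidean_space set \<Rightarrow> ('a \<Rightarrow> 'a) \<Rightarrow> bool" where
  "unit_normal_field S N \<longleftrightarrow>
     smooth_on_subset S N \<and>
     (\<forall>p\<in>S. norm (N p) = 1 \<and> (\<forall>X\<in>tangent_space S p. N p \<bullet> X = 0))"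

text \<open>
  The ambient Levi-Civita connection is the flat one, so the covariant derivative along \<open>S\<close> is
  the directional derivative. The derivative within \<open>S\<close> is not unique as a linear map on the
  ambient space, but any two choices agree on \<open>tangent_space S p\<close>; the following is only
  meaningful (and only used) for \<open>X\<close> in the tangent space.
\<close>

definition deriv_along :: "'a::euclidean_space set \<Rightarrow> ('a \<Rightarrow> 'b::euclidean_space) \<Rightarrow> 'a \<Rightarrow> 'a \<Rightarrow> 'b" where
  "deriv_along S F p X = frechet_derivative F (at p within S) X"

definition shape_operator :: "'a::euclidean_space set \<Rightarrow> ('a \<Rightarrow> 'a) \<Rightarrow> 'a \<Rightarrow> 'a \<Rightarrow> 'a" where
  "shape_operator S N p X = - deriv_along S N p X"

text \<open>Trace of a linear endomorphism \<open>L\<close> of a linear subspace \<open>V\<close> (independent of the basis \<open>B\<close>).\<close>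

definition trace_on :: "'a::euclidean_space set \<Rightarrow> ('a \<Rightarrow> 'a) \<Rightarrow> real" where
  "trace_on V L =
     (let B = (SOME B. independent B \<and> span B = V) in \<Sum>b\<in>B. representation B (L b) b)"

definition mean_curvature :: "'a::euclidean_space set \<Rightarrow> ('a \<Rightarrow> 'a) \<Rightarrow> 'a \<Rightarrow> real" where
  "mean_curvature S N p = trace_on (tangent_space S p) (shape_operator S N p)"

definition minimal_hypersurface :: "'a::euclidean_space set \<Rightarrow> bool" where
  "minimal_hypersurface S \<longleftrightarrow>
     embedded_hypersurface S \<and>
     (\<exists>N. unit_normal_field S N \<and> (\<forall>p\<in>S. mean_curvature S N p = 0))"

definition gradient_on :: "'a::euclidean_space set \<Rightarrow> ('a \<Rightarrow> real) \<Rightarrow> 'a \<Rightarrow> 'a" where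
  "gradient_on S f p =
     (THE v. v \<in> tangent_space S p \<and> (\<forall>X\<in>tangent_space S p. v \<bullet> X = deriv_along S f p X))"


section \<open>Vertical helicoids in a product with the real line\<close>

definition vertical_field :: "'m::euclidean_space \<times> real" where
  "vertical_field = (0, 1)"

definition angle_function ::
  "('m::euclidean_space \<times> real \<Rightarrow> 'm \<times> real) \<Rightarrow> 'm \<times> real \<Rightarrow> real" where
  "angle_function N p = N p \<bullet> vertical_field"

text \<open>The section at height \<open>t\<close>, with \<open>M \<times> {t}\<close> identified with \<open>M\<close>.\<close>

definition horizontal_section :: "('m::euclidean_space \<times> real) set \<Rightarrow> real \<Rightarrow> 'm set" where
  "horizontal_section S t = {x. (x, t) \<in> S}"

text \<open>
  The height function is \<^const>\<open>snd\<close>. Without horizontal points every slice \<open>M \<times> {t}\<close> is transversal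
  to \<open>S\<close>, so all \<open>t\<close> are taken into account.
\<close>

definition vertical_helicoid :: "('m::euclidean_space \<times> real) set \<Rightarrow> bool" where
  "vertical_helicoid S \<longleftrightarrow>
     embedded_hypersurface S \<and>
     (\<exists>N. unit_normal_field S N \<and>
        (\<forall>p\<in>S. (angle_function N p)\<^sup>2 \<noteq> 1) \<and>
        \<not> (angle_function N) constant_on S \<and>
        (\<forall>t. minimal_hypersurface (horizontal_section S t)) \<and>
        (\<forall>p\<in>S. shape_operator S N p (gradient_on S snd p) \<bullet> gradient_on S snd p = 0))"


section \<open>Zero mean isocurved hypersurfaces\<close>

definition lorentz_product :: "'m::euclidean_space \<times> real \<Rightarrow> 'm \<times> real \<Rightarrow> real" where
  "lorentz_product X Y = fst X \<bullet> fst Y - snd X * snd Y"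

definition spacelike :: "('m::euclidean_space \<times> real) set \<Rightarrow> bool" where
  "spacelike S \<longleftrightarrow> (\<forall>p\<in>S. \<forall>X\<in>tangent_space S p. X \<noteq> 0 \<longrightarrow> lorentz_product X X > 0)"

definition lorentz_normal ::
  "('m::euclidean_space \<times> real \<Rightarrow> 'm \<times> real) \<Rightarrow> 'm \<times> real \<Rightarrow> 'm \<times> real" where
  "lorentz_normal N p =
     (- 1 / sqrt (2 * (angle_function N p)\<^sup>2 - 1)) *\<^sub>R
       (N p - (2 * angle_function N p) *\<^sub>R vertical_field)"

text \<open>
  The Riemannian and the Lorentzian product metric have the same Levi-Civita connection, so
  \<^const>\<open>shape_operator\<close> applied to the Lorentzian normal is the Lorentzian shape operator.
\<close>

definition lorentz_mean_curvature ::
  "('m::euclidean_space \<times> real) set \<Rightarrow> ('m \<times> real \<Rightarrow> 'm \<times> real) \<Rightarrow> 'm \<times> real \<Rightarrow> real" where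
  "lorentz_mean_curvature S N p =
     - trace_on (tangent_space S p) (shape_operator S (lorentz_normal N) p)"

definition zero_mean_isocurved :: "('m::euclidean_space \<times> real) set \<Rightarrow> bool" where
  "zero_mean_isocurved S \<longleftrightarrow>
     embedded_hypersurface S \<and> spacelike S \<and>
     (\<exists>N. unit_normal_field S N \<and>
        (\<forall>p\<in>S. mean_curvature S N p = 0 \<and> lorentz_mean_curvature S N p = 0))"


section \<open>Twisted cones over Clifford tori\<close>

text \<open>\<open>\<real>\<^bsup>2n+2\<^esup>\<close> is \<open>\<real>\<^bsup>n+1\<^esup> \<times> \<real>\<^bsup>n+1\<^esup>\<close>, with \<open>CARD('n) = n + 1\<close>.\<close>

definition clifford_torus :: "((real^'n) \<times> (real^'n)) set" where
  "clifford_torus = sphere 0 (1 / sqrt 2) \<times> sphere 0 (1 / sqrt 2)"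

definition cone_over :: "'a::real_vector set \<Rightarrow> 'a set" where
  "cone_over S = {r *\<^sub>R p | r p. r > 0 \<and> p \<in> S}"

text \<open>The linear map of the block matrix with rows \<open>(0, -Id)\<close> and \<open>(Id, 0)\<close>.\<close>

definition J_map :: "(real^'n) \<times> (real^'n) \<Rightarrow> (real^'n) \<times> (real^'n)" where
  "J_map p = (- snd p, fst p)"

text \<open>The exponential \<open>e\<^sup>L\<close> of a linear endomorphism \<open>L\<close>, evaluated at \<open>p\<close>.\<close>

definition exp_map :: "('a::euclidean_space \<Rightarrow> 'a) \<Rightarrow> 'a \<Rightarrow> 'a" where
  "exp_map L p = (\<Sum>j. (1 / fact j) *\<^sub>R (L ^^ j) p)"

definition twisting :: "real \<Rightarrow> real \<Rightarrow> (((real^'n) \<times> (real^'n)) \<times> real) set" where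
  "twisting a k =
     {(exp_map (\<lambda>v. (k * s) *\<^sub>R J_map v) p, a * s) | p s. p \<in> cone_over clifford_torus}"

end

theory Submission
  imports Defs
begin

text \<open>
  With \<open>z = x + i y\<close> and \<open>c = k / a\<close>, the twisting is the set of \<open>(z, t)\<close> with \<open>z \<noteq> 0\<close> and
  \<open>q \<bullet> R\<^sub>t q = 0\<close>, where \<open>R\<^sub>t z = e\<^sup>2\<^sup>i\<^sup>c\<^sup>t (cnj z)\<close> is a trace-free orthogonal involution. Its normal
  direction is \<open>G = (R\<^sub>t q, c w)\<close> with \<open>w = q \<bullet> R'\<^sub>t q\<close>, where \<open>R'\<^sub>t\<close> is the reflection turned by a
  quarter, and \<open>R\<^sub>t q\<close> is orthogonal to \<open>R'\<^sub>t q\<close>. These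
  relations make the ambient derivatives of both unit normals map every vector into the tangent
  space and have ambient trace zero, so \<open>H\<close> and \<open>H\<^sub>L\<close> vanish identically, for every \<open>k\<close>. The spacelike
  part is \<open>c\<^sup>2 w\<^sup>2 > |q|\<^sup>2\<close>; as \<open>w\<close> is quadratic in \<open>q\<close>, it is reached by moving away from the axis.
\<close>

section \<open>Smooth maps\<close>

text \<open>On an open set a derivative depends only on nearby values, so agreement on
  \<open>U\<close> passes to the directional derivatives of every order.\<close>

lemma Ck_on_cong:
  assumes "open U" "\<And>x. x \<in> U \<Longrightarrow> f x = g x"
  shows "Ck_on k U f \<longleftrightarrow> Ck_on k U g"
  using assms(2)
proof (induction k arbitrary: f g)
  case 0
  then show ?case by (auto cong: continuous_on_cong)
next
  case (Suc k)
  have hd: "(f has_derivative D) (at x) \<longleftrightarrow> (g has_derivative D) (at x)" if "x \<in> U" for x D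
    using has_derivative_transform_within_open[OF _ assms(1) that] Suc.prems by metis
  then have "f differentiable at x \<longleftrightarrow> g differentiable at x" if "x \<in> U" for x
    using that by (simp add: differentiable_def)
  moreover have "frechet_derivative f (at x) = frechet_derivative g (at x)" if "x \<in> U" for x
    using that hd by (simp add: frechet_derivative_def)
  then have "Ck_on k U (\<lambda>x. frechet_derivative f (at x) v) \<longleftrightarrow>
    Ck_on k U (\<lambda>x. frechet_derivative g (at x) v)" for v
    by (intro Suc.IH) simp
  ultimately show ?case by simp
qed

text \<open>\<open>frechet_derivative\<close> is a choice operator; here an explicit formula,
  correct on \<open>U\<close>, stands in for it.\<close>

lemma Ck_on_SucI:
  assumes "open U" "\<And>x. x \<in> U \<Longrightarrow> (f has_derivative f' x) (at x)"
    and "\<And>v. Ck_on k U (\<lambda>x. f' x v)"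
  shows "Ck_on (Suc k) U f"
proof -
  have "Ck_on k U (\<lambda>x. frechet_derivative f (at x) v)" for v
    by (rule iffD1[OF Ck_on_cong[OF assms(1)] assms(3)])
      (simp add: frechet_derivative_at[OF assms(2), symmetric])
  moreover have "f differentiable at x" if "x \<in> U" for x
    using assms(2)[OF that] by (rule differentiableI)
  ultimately show ?thesis by simp
qed

lemma Ck_on_SucD:
  assumes "Ck_on (Suc k) U f"
  shows "x \<in> U \<Longrightarrow> (f has_derivative frechet_derivative f (at x)) (at x)"
    and "Ck_on k U (\<lambda>x. frechet_derivative f (at x) v)"
  using assms frechet_derivative_works by auto

text \<open>The Leibniz and chain rules keep an undifferentiated factor, so the inductions also need
  the lower order for the function itself.\<close>

lemma Ck_on_Suc_imp: "Ck_on (Suc k) U f \<Longrightarrow> Ck_on k U f"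
proof (induction k arbitrary: f)
  case 0
  then have "isCont f x" if "x \<in> U" for x
    using that differentiable_imp_continuous_within[of f x UNIV] by simp
  then show ?case by (simp add: continuous_at_imp_continuous_on)
next
  case (Suc k)
  then show ?case by (metis Ck_on.simps(2))
qed

lemma Ck_on_const: "open U \<Longrightarrow> Ck_on k U (\<lambda>_. c)"
proof (induction k arbitrary: c)
  case (Suc k)
  then show ?case by (intro Ck_on_SucI[where f' = "\<lambda>_ _. 0"]) auto
qed simp

lemma Ck_on_bounded_linear:
  assumes "bounded_linear L" "open U" "Ck_on k U f"
  shows "Ck_on k U (\<lambda>x. L (f x))"
  using assms(3)
proof (induction k arbitrary: f)
  case 0
  then show ?case by (simp add: assms(1) bounded_linear.continuous_on)
next
  case (Suc k)
  show ?case
    by (rule Ck_on_SucI[OF assms(2) bounded_linear.has_derivative[OF assms(1) Ck_on_SucD(1)[OF Suc.prems]]])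
      (use Suc in auto)
qed

lemma Ck_on_ident: "open U \<Longrightarrow> Ck_on k U (\<lambda>x. x)"
proof (cases k)
  case (Suc m)
  assume "open U"
  then show ?thesis
    unfolding Suc by (intro Ck_on_SucI[where f' = "\<lambda>_ v. v"] Ck_on_const) auto
qed simp

lemma Ck_on_add:
  assumes "open U" "Ck_on k U f" "Ck_on k U g"
  shows "Ck_on k U (\<lambda>x. f x + g x)"
  using assms(2,3)
proof (induction k arbitrary: f g)
  case 0
  then show ?case by (simp add: continuous_on_add)
next
  case (Suc k)
  show ?case
    by (rule Ck_on_SucI[OF assms(1) has_derivative_add[OF Ck_on_SucD(1)[OF Suc.prems(1)] Ck_on_SucD(1)[OF Suc.prems(2)]]])
      (use Suc in auto)
qed

text \<open>The Leibniz rule gives a sum of two terms of the same bilinear form, so the induction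
  closes. Scaling, products and inner products are instances.\<close>

lemma Ck_on_bounded_bilinear:
  assumes "bounded_bilinear B" "open U" "Ck_on k U f" "Ck_on k U g"
  shows "Ck_on k U (\<lambda>x. B (f x) (g x))"
  using assms(3,4)
proof (induction k arbitrary: f g)
  case 0
  then show ?case by (simp add: bounded_bilinear.continuous_on[OF assms(1)])
next
  case (Suc k)
  note D = bounded_bilinear.FDERIV[OF assms(1) Ck_on_SucD(1)[OF Suc.prems(1)] Ck_on_SucD(1)[OF Suc.prems(2)]]
  show ?case
    by (rule Ck_on_SucI[OF assms(2) D])
      (assumption, assumption, intro Ck_on_add assms(2) Suc.IH Ck_on_Suc_imp[OF Suc.prems(1)] Ck_on_Suc_imp[OF Suc.prems(2)]
        Ck_on_SucD(2)[OF Suc.prems(1)] Ck_on_SucD(2)[OF Suc.prems(2)])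
qed

text \<open>Outer functions of one real variable suffice for sine, cosine and powers; their chain
  rule is a product, which the bilinear case handles.\<close>

lemma Ck_on_compose_real:
  fixes h :: "real \<Rightarrow> real"
  assumes "open U" "open I" "Ck_on k I h" "Ck_on k U f" "f ` U \<subseteq> I"
  shows "Ck_on k U (\<lambda>x. h (f x))"
  using assms(3,4)
proof (induction k arbitrary: h)
  case 0
  then show ?case using continuous_on_compose2[of I h U f] assms(5) by simp
next
  case (Suc k)
  let ?h' = "\<lambda>y. frechet_derivative h (at y) 1"
  have h': "frechet_derivative h (at y) z = ?h' y * z" if "y \<in> I" for y z
    using linear_scale[OF has_derivative_linear[OF Ck_on_SucD(1)[OF Suc.prems(1) that]], of z 1] by simp
  have "((\<lambda>x. h (f x)) has_derivative (\<lambda>v. ?h' (f x) * frechet_derivative f (at x) v)) (at x)" if "x \<in> U" for x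
  proof -
    have "f x \<in> I" using assms(5) that by auto
    from has_derivative_compose[OF Ck_on_SucD(1)[OF Suc.prems(2) that] Ck_on_SucD(1)[OF Suc.prems(1) this]]
    show ?thesis by (rule has_derivative_eq_rhs) (intro ext h' \<open>f x \<in> I\<close>)
  qed
  then show ?case
    by (rule Ck_on_SucI[OF assms(1)])
      (assumption, rule Ck_on_bounded_bilinear[OF bounded_bilinear_mult assms(1)
        Suc.IH[OF Ck_on_SucD(2)[OF Suc.prems(1)] Ck_on_Suc_imp[OF Suc.prems(2)]] Ck_on_SucD(2)[OF Suc.prems(2)]])
qed

text \<open>Each function is the derivative of the other up to sign, so the two inductions run
  together.\<close>

lemma Ck_on_sin_cos: "Ck_on k UNIV (sin :: real \<Rightarrow> real) \<and> Ck_on k UNIV (cos :: real \<Rightarrow> real)"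
proof (induction k)
  case 0
  then show ?case by (simp add: continuous_on_sin continuous_on_cos)
next
  case (Suc k)
  have "Ck_on (Suc k) UNIV (sin :: real \<Rightarrow> real)"
  proof (rule Ck_on_SucI[where f' = "\<lambda>x v. cos x * v"])
    show "Ck_on k UNIV (\<lambda>x::real. cos x * v)" for v
      using Suc by (intro Ck_on_bounded_linear[OF bounded_linear_mult_left]) auto
  qed (auto intro!: derivative_eq_intros)
  moreover have "Ck_on (Suc k) UNIV (cos :: real \<Rightarrow> real)"
  proof (rule Ck_on_SucI[where f' = "\<lambda>x v. sin x * (- v)"])
    show "Ck_on k UNIV (\<lambda>x::real. sin x * (- v))" for v
      using Suc by (intro Ck_on_bounded_linear[OF bounded_linear_mult_left]) auto
  qed (auto intro!: derivative_eq_intros)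
  ultimately show ?case by simp
qed

text \<open>Differentiation lowers the exponent by one, so \<open>a\<close> stays arbitrary in the
  induction.\<close>

lemma Ck_on_powr: "Ck_on k {0<..} (\<lambda>x::real. x powr a)"
proof (induction k arbitrary: a)
  case 0
  then show ?case by (auto intro!: continuous_intros)
next
  case (Suc k)
  show ?case
  proof (rule Ck_on_SucI[where f' = "\<lambda>x v. x powr (a - 1) * (a * v)"])
    show "((\<lambda>x. x powr a) has_derivative (\<lambda>v. x powr (a - 1) * (a * v))) (at x)" if "x \<in> {0<..}" for x :: real
    proof -
      have "((\<lambda>x. x powr a) has_real_derivative a * x powr (a - 1)) (at x)"
        using that by (intro has_real_derivative_powr) auto
      then show ?thesis
        unfolding has_field_derivative_def by (rule has_derivative_eq_rhs) (auto simp: mult_ac)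
    qed
    show "Ck_on k {0<..} (\<lambda>x. x powr (a - 1) * (a * v))" for v
      by (intro Ck_on_bounded_linear[OF bounded_linear_mult_left] Suc) auto
  qed auto
qed

lemma Ck_on_subset: "Ck_on k U f \<Longrightarrow> V \<subseteq> U \<Longrightarrow> Ck_on k V f"
  by (induction k arbitrary: f) (auto intro: continuous_on_subset)

lemma smooth_on_mono: "smooth_on U f \<Longrightarrow> V \<subseteq> U \<Longrightarrow> smooth_on V f"
  unfolding smooth_on_def using Ck_on_subset by blast

lemma smooth_on_imp_continuous_on: "smooth_on U f \<Longrightarrow> continuous_on U f"
  unfolding smooth_on_def using Ck_on.simps(1) by blast

section \<open>Closure rules for smooth maps\<close>

named_theorems smooth_intros

lemma smooth_on_const [smooth_intros]: "open U \<Longrightarrow> smooth_on U (\<lambda>_. c)"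
  by (simp add: smooth_on_def Ck_on_const)

lemma smooth_on_ident [smooth_intros]: "open U \<Longrightarrow> smooth_on U (\<lambda>x. x)"
  by (simp add: smooth_on_def Ck_on_ident)

lemma smooth_on_bounded_linear:
  "bounded_linear L \<Longrightarrow> open U \<Longrightarrow> smooth_on U f \<Longrightarrow> smooth_on U (\<lambda>x. L (f x))"
  by (simp add: smooth_on_def Ck_on_bounded_linear)

lemma smooth_on_bounded_bilinear:
  "bounded_bilinear B \<Longrightarrow> open U \<Longrightarrow> smooth_on U f \<Longrightarrow> smooth_on U g \<Longrightarrow> smooth_on U (\<lambda>x. B (f x) (g x))"
  by (simp add: smooth_on_def Ck_on_bounded_bilinear)

lemmas smooth_on_fst [smooth_intros] = smooth_on_bounded_linear[OF bounded_linear_fst]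
lemmas smooth_on_snd [smooth_intros] = smooth_on_bounded_linear[OF bounded_linear_snd]
lemmas smooth_on_scaleR [smooth_intros] = smooth_on_bounded_bilinear[OF bounded_bilinear_scaleR]
lemmas smooth_on_mult [smooth_intros] = smooth_on_bounded_bilinear[OF bounded_bilinear_mult]
lemmas smooth_on_inner [smooth_intros] = smooth_on_bounded_bilinear[OF bounded_bilinear_inner]

lemma smooth_on_add [smooth_intros]:
  "open U \<Longrightarrow> smooth_on U f \<Longrightarrow> smooth_on U g \<Longrightarrow> smooth_on U (\<lambda>x. f x + g x)"
  by (simp add: smooth_on_def Ck_on_add)

lemma smooth_on_diff [smooth_intros]:
  "open U \<Longrightarrow> smooth_on U f \<Longrightarrow> smooth_on U g \<Longrightarrow> smooth_on U (\<lambda>x. f x - g x)"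
  using smooth_on_add[of U f "\<lambda>x. - g x"]
    smooth_on_bounded_linear[OF bounded_linear_minus[OF bounded_linear_ident], of U g] by simp

lemma smooth_on_Pair [smooth_intros]:
  assumes "open U" "smooth_on U f" "smooth_on U g"
  shows "smooth_on U (\<lambda>x. (f x, g x))"
proof -
  \<comment> \<open>A pair is the sum of its images under the linear inclusions of the two
    factors.\<close>
  have "smooth_on U (\<lambda>x. (f x, 0))"
    using bounded_linear_Pair[OF bounded_linear_ident bounded_linear_zero] assms(1,2)
    by (rule smooth_on_bounded_linear)
  moreover have "smooth_on U (\<lambda>x. (0, g x))"
    using bounded_linear_Pair[OF bounded_linear_zero bounded_linear_ident] assms(1,3)
    by (rule smooth_on_bounded_linear)
  ultimately have "smooth_on U (\<lambda>x. (f x, 0) + (0, g x))"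
    by (intro smooth_on_add assms)
  then show ?thesis by simp
qed

lemma smooth_on_sin [smooth_intros]: "open U \<Longrightarrow> smooth_on U f \<Longrightarrow> smooth_on U (\<lambda>x. sin (f x :: real))"
  unfolding smooth_on_def
  using Ck_on_compose_real[OF _ open_UNIV Ck_on_sin_cos[THEN conjunct1]] by blast

lemma smooth_on_cos [smooth_intros]: "open U \<Longrightarrow> smooth_on U f \<Longrightarrow> smooth_on U (\<lambda>x. cos (f x :: real))"
  unfolding smooth_on_def
  using Ck_on_compose_real[OF _ open_UNIV Ck_on_sin_cos[THEN conjunct2]] by blast

lemma smooth_on_powr [smooth_intros]:
  fixes f :: "_ \<Rightarrow> real"
  assumes "open U" "smooth_on U f" "\<And>x. x \<in> U \<Longrightarrow> f x > 0"
  shows "smooth_on U (\<lambda>x. f x powr a)"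
  unfolding smooth_on_def
proof
  show "Ck_on k U (\<lambda>x. f x powr a)" for k
    using assms by (intro Ck_on_compose_real[OF _ _ Ck_on_powr])
      (auto simp: smooth_on_def)
qed

section \<open>Tangent spaces and traces\<close>

text \<open>Along a curve in \<open>S\<close> with velocity \<open>X\<close>, the chain rule turns
  both candidates into the derivative of the same function of one variable.\<close>

lemma has_derivative_unique_tangent_space:
  assumes X: "X \<in> tangent_space S p"
    and F: "(F has_derivative D) (at p within S)" and G: "(F has_derivative D') (at p within S)"
  shows "D X = D' X"
proof -
  obtain \<gamma> :: "real \<Rightarrow> 'a" and e where e: "e > 0" and im: "\<gamma> ` {-e<..<e} \<subseteq> S" and 0: "\<gamma> 0 = p"
    and d: "(\<gamma> has_vector_derivative X) (at 0)"
    using X unfolding tangent_space_def by blast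
  have *: "((F \<circ> \<gamma>) has_vector_derivative E X) (at 0)" if "(F has_derivative E) (at p within S)" for E
  proof -
    have "(F has_derivative E) (at (\<gamma> 0) within \<gamma> ` {-e<..<e})"
      using has_derivative_subset[OF that im] 0 by simp
    then have "((F \<circ> \<gamma>) has_vector_derivative E X) (at 0 within {-e<..<e})"
      using d by (intro vector_derivative_diff_chain_within) (auto intro: has_vector_derivative_at_within)
    then show ?thesis
      using e by (subst (asm) at_within_open) auto
  qed
  show ?thesis
    using vector_derivative_unique_at[OF *[OF F] *[OF G]] .
qed

text \<open>Whichever derivative within \<open>S\<close> is selected, tangent vectors cannot
  distinguish it from \<open>D\<close>, so ambient formulas may be used.\<close>

lemma deriv_along_eq:
  assumes "X \<in> tangent_space S p" "(F has_derivative D) (at p within S)"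
  shows "deriv_along S F p X = D X"
proof -
  have "(F has_derivative frechet_derivative F (at p within S)) (at p within S)"
    using assms(2) frechet_derivative_works differentiable_def by blast
  then show ?thesis
    unfolding deriv_along_def by (rule has_derivative_unique_tangent_space[OF assms(1) _ assms(2)])
qed

text \<open>Since \<open>g\<close> is constant on \<open>S\<close>, the zero map is another
  derivative of \<open>g\<close> within \<open>S\<close>.\<close>

lemma tangent_space_subset_kernel:
  assumes "X \<in> tangent_space S p" "(g has_derivative D) (at p)" "p \<in> S" "\<And>x. x \<in> S \<Longrightarrow> g x = 0"
  shows "D X = 0"
proof -
  have "(g has_derivative (\<lambda>_. 0)) (at p within S)"
    by (rule has_derivative_transform[OF \<open>p \<in> S\<close>, where f = "\<lambda>_. 0"]) (simp_all add: assms(4))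
  from has_derivative_unique_tangent_space[OF assms(1) has_derivative_at_withinI[OF assms(2)] this]
  show ?thesis .
qed

text \<open>By continuity a curve through \<open>p\<close> stays in \<open>V'\<close> for a short
  time, and shrinking its interval keeps the velocity. This carries the tangent spaces over to the
  spacelike part.\<close>

lemma tangent_space_Int_open:
  assumes "open V'" "p \<in> V'"
  shows "tangent_space (S \<inter> V') p = tangent_space S p"
proof
  show "tangent_space (S \<inter> V') p \<subseteq> tangent_space S p"
    unfolding tangent_space_def by blast
  show "tangent_space S p \<subseteq> tangent_space (S \<inter> V') p"
  proof
    fix X assume "X \<in> tangent_space S p"
    then obtain \<gamma> :: "real \<Rightarrow> 'a" and e where e: "e > 0" and im: "\<gamma> ` {-e<..<e} \<subseteq> S" and 0: "\<gamma> 0 = p"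
      and sm: "smooth_on {-e<..<e} \<gamma>" and d: "(\<gamma> has_vector_derivative X) (at 0)"
      unfolding tangent_space_def by blast
    have "isCont \<gamma> 0"
      using has_vector_derivative_continuous[OF d] .
    then have "\<forall>\<^sub>F s in nhds 0. \<gamma> s \<in> V'"
      using assms 0 by (simp add: eventually_at_topological eventually_nhds continuous_at_open)
    then obtain d' where d': "d' > 0" "\<And>s. dist s 0 < d' \<Longrightarrow> \<gamma> s \<in> V'"
      unfolding eventually_nhds_metric by blast
    define e' where "e' = min e d'"
    have "e' > 0" "{-e'<..<e'} \<subseteq> {-e<..<e}" "{-e'<..<e'} \<subseteq> {-d'<..<d'}"
      using e d' by (auto simp: e'_def)
    moreover have "\<gamma> s \<in> V'" if "s \<in> {-d'<..<d'}" for s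
      using d'(2)[of s] that by auto
    ultimately have "e' > 0" "{-e'<..<e'} \<subseteq> {-e<..<e}" "\<gamma> ` {-e'<..<e'} \<subseteq> S \<inter> V'"
      using im by blast+
    then show "X \<in> tangent_space (S \<inter> V') p"
      unfolding tangent_space_def using smooth_on_mono[OF sm] 0 d by blast
  qed
qed

text \<open>As \<open>L\<close> maps into \<open>V\<close>, the normal direction contributes nothing to its ambient trace.\<close>

lemma trace_on_hyperplane:
  fixes L :: "'a::euclidean_space \<Rightarrow> 'a"
  assumes L: "linear L" and G: "G \<noteq> 0" and tangential: "\<And>X. L X \<bullet> G = 0"
    and V: "V = {X. X \<bullet> G = 0}" and eq: "\<And>X. X \<in> V \<Longrightarrow> L' X = L X"
  shows "trace_on V L' = (\<Sum>e\<in>Basis. L e \<bullet> e)"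
proof -
  have subV: "subspace V"
    unfolding V by (auto simp: subspace_def inner_left_distrib)
  define B where "B = (SOME B. independent B \<and> span B = V)"
  have "\<exists>B. independent B \<and> span B = V"
    using subV by (metis basis_exists span_subspace)
  then have B: "independent B" "span B = V"
    unfolding B_def by (metis (mono_tags, lifting) someI_ex)+
  have fin: "finite B" using B(1) independent_imp_finite by blast
  \<comment> \<open>\<open>P\<close> is the orthogonal projection onto \<open>V\<close>.\<close>
  define P where "P v = v - ((v \<bullet> G) / (G \<bullet> G)) *\<^sub>R G" for v
  have P_V: "P v \<in> span B" for v
    using G by (auto simp: P_def B V inner_diff_left)
  have linP: "linear P"
    by (rule linearI) (auto simp: P_def inner_left_distrib algebra_simps add_divide_distrib)
  \<comment> \<open>\<open>d b\<close> represents the coordinate functional of \<open>b\<close>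
    composed with \<open>P\<close>. It plays the role of a dual basis, as the chosen
    \<open>B\<close> need not be orthonormal.\<close>
  define d where "d b = (\<Sum>e\<in>Basis. representation B (P e) b *\<^sub>R e)" for b
  have rep_lin: "linear (\<lambda>v. representation B (P v) b)" for b
    using P_V linear_add[OF linP] linear_scale[OF linP]
    by (intro linearI) (simp_all add: representation_add[OF B(1)] representation_scale[OF B(1)])
  have d: "v \<bullet> d b = representation B (P v) b" for v b
  proof -
    have "representation B (P v) b = representation B (P (\<Sum>e\<in>Basis. (v \<bullet> e) *\<^sub>R e)) b"
      by (simp add: euclidean_representation)
    also have "\<dots> = (\<Sum>e\<in>Basis. (v \<bullet> e) * representation B (P e) b)"
      by (simp add: linear_sum[OF rep_lin] linear_scale[OF rep_lin])
    finally show ?thesis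
      by (simp add: d_def inner_sum_right mult.commute)
  qed
  have P_id: "P v = v" if "v \<bullet> G = 0" for v
    using that by (simp add: P_def)
  have "trace_on V L' = (\<Sum>b\<in>B. representation B (L' b) b)"
    by (simp add: trace_on_def B_def[symmetric])
  also have "\<dots> = (\<Sum>b\<in>B. L b \<bullet> d b)"
  proof (rule sum.cong)
    fix b assume "b \<in> B"
    then have "b \<in> V" using B(2) span_base by blast
    then show "representation B (L' b) b = L b \<bullet> d b"
      by (simp add: d eq P_id tangential)
  qed simp
  also have "\<dots> = (\<Sum>b\<in>B. \<Sum>e\<in>Basis. (L b \<bullet> e) * (e \<bullet> d b))"
    by (subst euclidean_inner) (simp add: inner_commute)
  also have "\<dots> = (\<Sum>e\<in>Basis. L (P e) \<bullet> e)"
  proof (subst sum.swap, rule sum.cong)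
    fix e :: 'a assume "e \<in> Basis"
    have "P e = (\<Sum>b\<in>B. (e \<bullet> d b) *\<^sub>R b)"
      using sum_representation_eq[OF B(1) P_V fin subset_refl] by (simp add: d)
    then have "L (P e) = (\<Sum>b\<in>B. (e \<bullet> d b) *\<^sub>R L b)"
      by (simp add: linear_sum[OF L] linear_scale[OF L])
    then show "(\<Sum>b\<in>B. (L b \<bullet> e) * (e \<bullet> d b)) = L (P e) \<bullet> e"
      by (simp add: inner_sum_left mult.commute)
  qed simp
  \<comment> \<open>Replacing \<open>P\<close> by the identity costs only the term
    \<open>L G \<bullet> G / (G \<bullet> G)\<close>, which vanishes because \<open>L\<close> maps
    into \<open>V\<close>.\<close>
  also have "\<dots> = (\<Sum>e\<in>Basis. L e \<bullet> e) - (\<Sum>e\<in>Basis. (G \<bullet> e) * (L G \<bullet> e)) / (G \<bullet> G)"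
    by (simp add: P_def linear_diff[OF L] linear_scale[OF L] inner_diff_right sum_subtractf
        sum_divide_distrib inner_commute)
  also have "(\<Sum>e\<in>Basis. (G \<bullet> e) * (L G \<bullet> e)) = L G \<bullet> G"
    by (subst (3) euclidean_inner) (simp add: mult.commute)
  finally show ?thesis by (simp add: tangential)
qed

section \<open>Twisted reflections\<close>

text \<open>Identifying \<open>(x, y)\<close> with \<open>z = x + i y\<close>, this is \<open>z \<mapsto> e\<^sup>i\<^sup>\<theta> (cnj z)\<close>.\<close>

definition twist_refl :: "real \<Rightarrow> 'a::euclidean_space \<times> 'a \<Rightarrow> 'a \<times> 'a" where
  "twist_refl \<theta> q = (cos \<theta> *\<^sub>R fst q + sin \<theta> *\<^sub>R snd q, sin \<theta> *\<^sub>R fst q - cos \<theta> *\<^sub>R snd q)"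

lemma linear_twist_refl: "linear (twist_refl \<theta>)"
  by (rule linearI) (auto simp: twist_refl_def algebra_simps)

lemmas twist_refl_linear_simps = linear_add[OF linear_twist_refl] linear_diff[OF linear_twist_refl]
  linear_scale[OF linear_twist_refl] linear_0[OF linear_twist_refl]

text \<open>Differentiating in the angle adds a quarter turn, so all derivatives stay within the
  family \<open>twist_refl\<close>.\<close>

lemma has_derivative_twist_refl [derivative_intros]:
  assumes "(h has_derivative h') (at p within A)" "(f has_derivative f') (at p within A)"
  shows "((\<lambda>x. twist_refl (h x) (f x)) has_derivative
    (\<lambda>X. twist_refl (h p) (f' X) + h' X *\<^sub>R twist_refl (h p + pi / 2) (f p))) (at p within A)"
  unfolding twist_refl_def
  by (rule derivative_eq_intros assms refl)+ (auto simp: sin_add cos_add algebra_simps)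

lemma smooth_on_twist_refl [smooth_intros]:
  "open U \<Longrightarrow> smooth_on U h \<Longrightarrow> smooth_on U f \<Longrightarrow> smooth_on U (\<lambda>x. twist_refl (h x) (f x))"
  unfolding twist_refl_def by (intro smooth_intros)

lemma twist_refl_twist_refl [simp]: "twist_refl \<theta> (twist_refl \<theta> q) = q"
proof -
  have "cos \<theta> *\<^sub>R cos \<theta> *\<^sub>R x + sin \<theta> *\<^sub>R sin \<theta> *\<^sub>R x = x" for x :: 'a
    using sin_cos_squared_add2[of \<theta>] by (metis power2_eq_square scaleR_add_left scaleR_one scaleR_scaleR sin_cos_squared_add3)
  then show ?thesis
    by (cases q) (simp add: twist_refl_def algebra_simps)
qed

lemma twist_refl_inner_commute: "twist_refl \<theta> p \<bullet> q = p \<bullet> twist_refl \<theta> q"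
  by (simp add: twist_refl_def inner_prod_def inner_add_left inner_add_right inner_diff_left inner_diff_right)

lemma twist_refl_inner_swap: "p \<bullet> twist_refl \<theta> q = q \<bullet> twist_refl \<theta> p"
  by (metis twist_refl_inner_commute inner_commute)

text \<open>A symmetric involution is orthogonal.\<close>

lemma twist_refl_inner_twist_refl [simp]: "twist_refl \<theta> p \<bullet> twist_refl \<theta> q = p \<bullet> q"
  by (simp add: twist_refl_inner_commute)

lemma twist_refl_add_pi: "twist_refl (\<theta> + pi / 2 + pi / 2) q = - twist_refl \<theta> q"
  by (simp add: twist_refl_def sin_add cos_add)

text \<open>The quarter turn multiplies the reflected vector by \<open>i\<close>, and
  \<open>v\<close> is always orthogonal to \<open>i v\<close>.\<close>

lemma twist_refl_inner_twist_refl_quarter [simp]: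
  "twist_refl \<theta> q \<bullet> twist_refl (\<theta> + pi / 2) q = 0" "twist_refl (\<theta> + pi / 2) q \<bullet> twist_refl \<theta> q = 0"
  by (simp_all add: twist_refl_def sin_add cos_add inner_prod_def inner_add_left inner_add_right
      inner_diff_left inner_diff_right inner_commute algebra_simps)

lemma sum_Basis_Pair:
  fixes f :: "'a::euclidean_space \<times> 'b::euclidean_space \<Rightarrow> 'c::comm_monoid_add"
  shows "(\<Sum>e\<in>Basis. f e) = (\<Sum>b\<in>Basis. f (b, 0)) + (\<Sum>b\<in>Basis. f (0, b))"
proof -
  have "(\<Sum>e\<in>Basis. f e) = sum f ((\<lambda>b. (b, 0)) ` Basis) + sum f ((\<lambda>b. (0, b)) ` Basis)"
    unfolding Basis_prod_def by (rule sum.union_disjoint) auto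
  then show ?thesis
    by (simp add: sum.reindex inj_on_def)
qed

text \<open>The diagonal blocks are \<open>cos \<theta>\<close> and \<open>- cos \<theta>\<close>
  times the identity, so their traces cancel.\<close>

lemma trace_twist_refl: "(\<Sum>e\<in>Basis. twist_refl \<theta> e \<bullet> e) = 0"
  by (simp add: sum_Basis_Pair twist_refl_def sum_negf)

section \<open>Level sets and normal fields\<close>

text \<open>The section at height \<open>t\<close> is the cone \<open>norm x = norm y\<close> turned
  by \<open>c * t\<close>; the reflection angle is twice that. The axis is left out because the
  gradient of the quadratic form vanishes there.\<close>

definition helicoid :: "real \<Rightarrow> (('a::euclidean_space \<times> 'a) \<times> real) set" where
  "helicoid c = {(q, t). q \<noteq> 0 \<and> q \<bullet> twist_refl (2 * c * t) q = 0}"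

text \<open>Up to the factor \<open>c\<close>, this is the height derivative of half the defining
  quadratic form.\<close>

definition slant :: "real \<Rightarrow> ('a::euclidean_space \<times> 'a) \<times> real \<Rightarrow> real" where
  "slant c p = fst p \<bullet> twist_refl (2 * c * snd p + pi / 2) (fst p)"

text \<open>For \<open>\<epsilon> = 1\<close> the gradient of \<open>\<lambda>(q, t). q \<bullet> twist_refl (2 c t) q / 2\<close>, for \<open>\<epsilon> = -1\<close> its Lorentzian
  counterpart.\<close>

definition conormal :: "real \<Rightarrow> real \<Rightarrow> ('a::euclidean_space \<times> 'a) \<times> real \<Rightarrow> ('a \<times> 'a) \<times> real" where
  "conormal \<epsilon> c p = (twist_refl (2 * c * snd p) (fst p), \<epsilon> * c * slant c p)"

text \<open>For \<open>\<epsilon> = 1\<close> the squared length of the conormal; for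
  \<open>\<epsilon> = -1\<close> minus its Lorentzian square, whose positivity cuts out the
  spacelike part.\<close>

definition sqnorm :: "real \<Rightarrow> real \<Rightarrow> ('a::euclidean_space \<times> 'a) \<times> real \<Rightarrow> real" where
  "sqnorm \<epsilon> c p = (c * slant c p)\<^sup>2 + \<epsilon> * (fst p \<bullet> fst p)"

text \<open>The leading sign \<open>\<epsilon>\<close> reproduces the minus sign in the
  normalisation of the Lorentzian normal.\<close>

definition normal :: "real \<Rightarrow> real \<Rightarrow> ('a::euclidean_space \<times> 'a) \<times> real \<Rightarrow> ('a \<times> 'a) \<times> real" where
  "normal \<epsilon> c p = (\<epsilon> * sqnorm \<epsilon> c p powr (- 1 / 2)) *\<^sub>R conormal \<epsilon> c p"

text \<open>The product rule for \<open>normal\<close>, simplified by the equation of the helicoid;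
  it serves as the derivative at points of the helicoid.\<close>

definition normal_deriv ::
    "real \<Rightarrow> real \<Rightarrow> ('a::euclidean_space \<times> 'a) \<times> real \<Rightarrow> ('a \<times> 'a) \<times> real \<Rightarrow> ('a \<times> 'a) \<times> real" where
  "normal_deriv \<epsilon> c p X =
     (let q = fst p; \<theta> = 2 * c * snd p; q' = twist_refl (\<theta> + pi / 2) q in
       (\<epsilon> * sqnorm \<epsilon> c p powr (- 1 / 2)) *\<^sub>R
         (twist_refl \<theta> (fst X) + (2 * c * snd X) *\<^sub>R q', 2 * \<epsilon> * c * (q' \<bullet> fst X))
       - (\<epsilon> * sqnorm \<epsilon> c p powr (- 3 / 2) * (2 * c\<^sup>2 * slant c p * (q' \<bullet> fst X) + \<epsilon> * (q \<bullet> fst X))) *\<^sub>R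
         conormal \<epsilon> c p)"

text \<open>The height derivative turns the reflection by a second quarter, giving minus the
  original one, whose quadratic form vanishes on the helicoid. Hence no term in \<open>snd X\<close>
  remains.\<close>

lemma has_derivative_slant:
  assumes "p \<in> helicoid c"
  shows "(slant c has_derivative (\<lambda>X. 2 * (twist_refl (2 * c * snd p + pi / 2) (fst p) \<bullet> fst X))) (at p)"
proof -
  have "fst p \<bullet> twist_refl (2 * c * snd p + pi / 2 + pi / 2) (fst p) = 0"
    using assms unfolding twist_refl_add_pi by (auto simp: helicoid_def)
  moreover have "u \<bullet> twist_refl \<theta> v = v \<bullet> twist_refl \<theta> u" for \<theta> and u v :: "'a \<times> 'a"
    by (metis twist_refl_inner_commute inner_commute)
  ultimately show ?thesis
    unfolding slant_def twist_refl_inner_commute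
    by - (rule derivative_eq_intros refl | simp add: inner_add_right fun_eq_iff)+
qed

lemma has_derivative_sqnorm:
  assumes "p \<in> helicoid c"
  shows "(sqnorm \<epsilon> c has_derivative
    (\<lambda>X. 2 * (2 * c\<^sup>2 * slant c p * (twist_refl (2 * c * snd p + pi / 2) (fst p) \<bullet> fst X) + \<epsilon> * (fst p \<bullet> fst X)))) (at p)"
  unfolding sqnorm_def
  by (rule derivative_eq_intros has_derivative_slant[OF assms] refl)+
    (auto simp: power2_eq_square algebra_simps inner_commute)

lemma has_derivative_conormal:
  assumes "p \<in> helicoid c"
  shows "(conormal \<epsilon> c has_derivative
    (\<lambda>X. (twist_refl (2 * c * snd p) (fst X) + (2 * c * snd X) *\<^sub>R twist_refl (2 * c * snd p + pi / 2) (fst p),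
      2 * \<epsilon> * c * (twist_refl (2 * c * snd p + pi / 2) (fst p) \<bullet> fst X)))) (at p)"
  unfolding conormal_def
  by (rule derivative_eq_intros has_derivative_slant[OF assms] refl)+ (auto simp: algebra_simps)

lemma has_derivative_normal:
  fixes p :: "('a::euclidean_space \<times> 'a) \<times> real"
  assumes "p \<in> helicoid c" "sqnorm \<epsilon> c p > 0"
  shows "(normal \<epsilon> c has_derivative normal_deriv \<epsilon> c p) (at p)"
proof -
  define m' where "m' X = 2 * (2 * c\<^sup>2 * slant c p * (twist_refl (2 * c * snd p + pi / 2) (fst p) \<bullet> fst X) + \<epsilon> * (fst p \<bullet> fst X))" for X :: "('a \<times> 'a) \<times> real"
  have "((\<lambda>y. y powr (- 1 / 2)) has_real_derivative (- 1 / 2) * sqnorm \<epsilon> c p powr (- 1 / 2 - 1)) (at (sqnorm \<epsilon> c p))"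
    using assms(2) by (rule has_real_derivative_powr)
  then have "((\<lambda>y. y powr (- 1 / 2)) has_derivative (\<lambda>h. (- 1 / 2) * sqnorm \<epsilon> c p powr (- 3 / 2) * h)) (at (sqnorm \<epsilon> c p))"
    unfolding has_field_derivative_def by (rule has_derivative_eq_rhs) auto
  from has_derivative_compose[OF has_derivative_sqnorm[OF assms(1)] this]
  have "((\<lambda>x. sqnorm \<epsilon> c x powr (- 1 / 2)) has_derivative (\<lambda>X. (- 1 / 2) * sqnorm \<epsilon> c p powr (- 3 / 2) * m' X)) (at p)"
    by (simp add: m'_def)
  from has_derivative_scaleR[OF has_derivative_mult_right[OF this, of \<epsilon>] has_derivative_conormal[OF assms(1), of \<epsilon>]]
  show ?thesis
    unfolding normal_def
    by (rule has_derivative_eq_rhs) (auto simp: fun_eq_iff normal_deriv_def m'_def Let_def)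
qed

lemma linear_normal_deriv: "linear (normal_deriv \<epsilon> c p)"
  by (rule linearI) (simp_all add: normal_deriv_def Let_def twist_refl_linear_simps algebra_simps inner_add_right)

section \<open>Tangentiality and trace of the derivative of the normal\<close>

lemma conormal_inner: "X \<bullet> conormal \<epsilon> c p = fst X \<bullet> twist_refl (2 * c * snd p) (fst p) + \<epsilon> * c * slant c p * snd X"
  by (simp add: conormal_def inner_prod_def)

lemma powr_neg_half_mult:
  assumes "m > 0" shows "m powr (- 3 / 2) * m = (m::real) powr (- 1 / 2)"
proof -
  have "m powr (- 3 / 2) * m = m powr (- 3 / 2) * m powr 1" using assms by simp
  also have "\<dots> = m powr (- 1 / 2)" by (simp only: powr_add[symmetric]) simp
  finally show ?thesis .
qed

lemma powr_neg_half_squared: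
  assumes "m > 0" shows "((m::real) powr (- 1 / 2))\<^sup>2 = 1 / m"
proof -
  have "(m powr (- 1 / 2))\<^sup>2 = m powr (- 1)"
    by (simp only: power2_eq_square powr_add[symmetric]) simp
  then show ?thesis using assms by (simp add: powr_minus_divide)
qed

text \<open>The product \<open>conormal \<epsilon> c p \<bullet> conormal 1 c p\<close> is the
  Euclidean or Lorentzian square of \<open>conormal \<epsilon> c p\<close>. Normalising makes this
  square constant, so the derivative has no normal part, in every ambient direction
  \<open>X\<close>.\<close>

lemma normal_deriv_tangential:
  assumes "sqnorm \<epsilon> c p > 0" "\<epsilon>\<^sup>2 = 1"
  shows "normal_deriv \<epsilon> c p X \<bullet> conormal 1 c p = 0"
proof -
  obtain q t where p: "p = (q, t)" by fastforce
  obtain u \<tau> where X: "X = (u, \<tau>)" by fastforce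
  define m where "m = sqnorm \<epsilon> c p"
  have K: "conormal \<epsilon> c p \<bullet> conormal 1 c p = \<epsilon> * m"
    using assms(2) by (simp add: conormal_inner) (simp add: m_def sqnorm_def p conormal_def power2_eq_square algebra_simps)
  \<comment> \<open>The derivative of the conormal contributes \<open>a + \<epsilon> * b\<close> and
    that of the normalising factor \<open>b + \<epsilon> * a\<close>; these agree up to the factor
    \<open>\<epsilon>\<close>.\<close>
  define a where "a = q \<bullet> u"
  define b where "b = 2 * c\<^sup>2 * slant c p * (twist_refl (2 * c * t + pi / 2) q \<bullet> u)"
  have 1: "(twist_refl (2 * c * t) u + (2 * c * \<tau>) *\<^sub>R twist_refl (2 * c * t + pi / 2) q,
      2 * \<epsilon> * c * (twist_refl (2 * c * t + pi / 2) q \<bullet> u)) \<bullet> conormal 1 c p = a + \<epsilon> * b"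
    by (simp add: conormal_inner a_def b_def p inner_add_left power2_eq_square inner_commute[of q u])
  have "normal_deriv \<epsilon> c p X \<bullet> conormal 1 c p =
      \<epsilon> * m powr (- 1 / 2) * (a + \<epsilon> * b) - \<epsilon> * m powr (- 3 / 2) * (b + \<epsilon> * a) * (\<epsilon> * m)"
    unfolding normal_deriv_def Let_def inner_diff_left inner_scaleR_left K m_def[symmetric]
    by (simp only: p X fst_conv snd_conv 1[unfolded p] a_def b_def)
  also have "\<dots> = \<epsilon> * m powr (- 1 / 2) * (a + \<epsilon> * b) - \<epsilon>\<^sup>2 * (m powr (- 3 / 2) * m) * (b + \<epsilon> * a)"
    by (simp add: power2_eq_square)
  also have "m powr (- 3 / 2) * m = m powr (- 1 / 2)"
    using assms(1) by (simp only: powr_neg_half_mult m_def)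
  also have "\<epsilon> * m powr (- 1 / 2) * (a + \<epsilon> * b) - \<epsilon>\<^sup>2 * m powr (- 1 / 2) * (b + \<epsilon> * a) =
      (1 - \<epsilon>\<^sup>2) * (\<epsilon> * m powr (- 1 / 2) * a)"
    by algebra
  finally show ?thesis by (simp add: assms(2))
qed

text \<open>Besides a multiple of the trace-free reflection there are only rank-one terms. Their
  traces are inner products of \<open>R q\<close> with its quarter turn and with \<open>q\<close>;
  both vanish on the helicoid.\<close>

lemma trace_normal_deriv:
  fixes p :: "('a::euclidean_space \<times> 'a) \<times> real"
  assumes "p \<in> helicoid c"
  shows "(\<Sum>e\<in>Basis. normal_deriv \<epsilon> c p e \<bullet> e) = 0"
proof -
  obtain q t where p: "p = (q, t)" by fastforce
  have q: "q \<bullet> twist_refl (2 * c * t) q = 0" using assms by (auto simp: p helicoid_def)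
  define A where "A = \<epsilon> * sqnorm \<epsilon> c p powr (- 1 / 2)"
  define B where "B = \<epsilon> * sqnorm \<epsilon> c p powr (- 3 / 2)"
  define r where "r = 2 * c * c * slant c p"
  have "(\<Sum>e\<in>Basis. normal_deriv \<epsilon> c p e \<bullet> e) =
      (\<Sum>b\<in>Basis. A * (twist_refl (2 * c * t) b \<bullet> b)
        - (B * r) * ((twist_refl (2 * c * t + pi / 2) q \<bullet> b) * (twist_refl (2 * c * t) q \<bullet> b))
        - (B * \<epsilon>) * ((q \<bullet> b) * (twist_refl (2 * c * t) q \<bullet> b)))"
    unfolding sum_Basis_Pair
    by (simp add: normal_deriv_def Let_def p conormal_def inner_diff_left A_def B_def r_def power2_eq_square algebra_simps)
  also have "\<dots> = A * (\<Sum>b\<in>(Basis :: ('a \<times> 'a) set). twist_refl (2 * c * t) b \<bullet> b)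
        - (B * r) * (twist_refl (2 * c * t + pi / 2) q \<bullet> twist_refl (2 * c * t) q) - (B * \<epsilon>) * (q \<bullet> twist_refl (2 * c * t) q)"
    unfolding sum_subtractf sum_distrib_left[symmetric] euclidean_inner[symmetric] by (rule refl)
  finally show ?thesis by (simp add: trace_twist_refl q)
qed

text \<open>Tangency of \<open>v\<close> removes the \<open>conormal\<close> term. What remains
  pairs \<open>R q\<close> with \<open>q\<close> or with its quarter turn. The factor
  \<open>l\<close> is free so as to match the gradient of the height.\<close>

lemma normal_deriv_gradient:
  assumes "p \<in> helicoid c" "v = ((- l * c * slant c p) *\<^sub>R twist_refl (2 * c * snd p) (fst p), l * (fst p \<bullet> fst p))"
  shows "normal_deriv 1 c p v \<bullet> v = 0"
proof -
  have q: "fst p \<bullet> twist_refl (2 * c * snd p) (fst p) = 0" using assms by (auto simp: helicoid_def)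
  have "v \<bullet> conormal 1 c p = 0"
    by (simp add: conormal_inner assms(2))
  then have "conormal 1 c p \<bullet> v = 0"
    by (simp add: inner_commute)
  moreover have "twist_refl (2 * c * snd p) (fst p) \<bullet> fst p = 0"
    using q by (simp add: twist_refl_inner_commute)
  ultimately show ?thesis
    by (simp add: normal_deriv_def Let_def inner_diff_left assms(2) twist_refl_linear_simps inner_add_left)
qed

section \<open>Tangent spaces of the helicoid and of its sections\<close>

text \<open>Straight lines are pushed onto the level set by rescaling the component in the
  \<open>(-1)\<close>-eigenspace of the reflection.\<close>

lemma helicoid_curve:
  fixes q u :: "'a::euclidean_space \<times> 'a"
  assumes qt: "(q, t) \<in> helicoid c" and tangent: "(u, \<tau>) \<bullet> conormal 1 c (q, t) = 0"
  obtains \<gamma> e where "e > 0" "smooth_on {-e<..<e} \<gamma>" "\<gamma> ` {-e<..<e} \<subseteq> helicoid c"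
    "\<gamma> 0 = (q, t)" "(\<gamma> has_vector_derivative (u, \<tau>)) (at 0)" "\<And>s. snd (\<gamma> s) = t + s * \<tau>"
proof -
  define P where "P s = q + s *\<^sub>R u" for s
  define Q where "Q s = twist_refl (2 * c * (t + s * \<tau>)) (P s)" for s
  define \<alpha> where "\<alpha> s = P s \<bullet> P s + P s \<bullet> Q s" for s
  define \<beta> where "\<beta> s = P s \<bullet> P s - P s \<bullet> Q s" for s
  \<comment> \<open>The components of \<open>P s\<close> in the two eigenspaces have squared lengths
    \<open>\<alpha> s / 2\<close> and \<open>\<beta> s / 2\<close>. Scaling the second one by
    \<open>\<rho> s\<close> makes the lengths equal.\<close>
  define \<rho> where "\<rho> s = \<alpha> s powr (1 / 2) * \<beta> s powr (- 1 / 2)" for s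
  define x where "x s = (1 / 2) *\<^sub>R (P s + Q s) + (\<rho> s / 2) *\<^sub>R (P s - Q s)" for s
  define \<gamma> where "\<gamma> s = (x s, t + s * \<tau>)" for s
  have q: "q \<noteq> 0" "q \<bullet> twist_refl (2 * c * t) q = 0"
    using qt by (auto simp: helicoid_def)
  have P0: "P 0 = q" "Q 0 = twist_refl (2 * c * t) q" by (simp_all add: P_def Q_def)
  have smP: "smooth_on UNIV P" unfolding P_def by (intro smooth_intros) auto
  have smQ: "smooth_on UNIV Q" unfolding Q_def by (intro smooth_intros smP) auto
  have sm\<alpha>: "smooth_on UNIV \<alpha>" unfolding \<alpha>_def by (intro smooth_intros smP smQ) auto
  have sm\<beta>: "smooth_on UNIV \<beta>" unfolding \<beta>_def by (intro smooth_intros smP smQ) auto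
  define m where "m = q \<bullet> q"
  have m: "m > 0" "\<alpha> 0 = m" "\<beta> 0 = m"
    using q by (simp_all add: m_def \<alpha>_def \<beta>_def P0)
  have "open ({s. \<alpha> s > 0} \<inter> {s. \<beta> s > 0})"
    using smooth_on_imp_continuous_on[OF sm\<alpha>] smooth_on_imp_continuous_on[OF sm\<beta>]
    by (intro open_Int open_Collect_less) auto
  then obtain e where e: "e > 0" "ball 0 e \<subseteq> {s. \<alpha> s > 0} \<inter> {s. \<beta> s > 0}"
    using m open_contains_ball_eq[of "{s. \<alpha> s > 0} \<inter> {s. \<beta> s > 0}" 0] by auto
  have ball: "ball 0 e = {-e<..<e}" by (simp add: ball_eq_greaterThanLessThan)
  have pos: "\<alpha> s > 0" "\<beta> s > 0" if "s \<in> {-e<..<e}" for s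
    using that e ball by auto
  have smooth: "smooth_on {-e<..<e} \<gamma>"
    unfolding \<gamma>_def x_def \<rho>_def divide_inverse
    by (intro smooth_intros smooth_on_mono[OF smP] smooth_on_mono[OF smQ] smooth_on_mono[OF sm\<alpha>]
        smooth_on_mono[OF sm\<beta>] pos) auto
  have on: "\<gamma> s \<in> helicoid c" if s: "s \<in> {-e<..<e}" for s
  proof -
    let ?R = "twist_refl (2 * c * (t + s * \<tau>))"
    have QQ: "Q s \<bullet> Q s = P s \<bullet> P s" by (simp add: Q_def)
    have "(y powr a)\<^sup>2 = y powr (2 * a)" for y a :: real
      by (simp add: power2_eq_square powr_add[symmetric])
    then have "(\<rho> s)\<^sup>2 = \<alpha> s * \<beta> s powr (- 1)"
      using pos[OF s] by (simp add: \<rho>_def power_mult_distrib)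
    then have \<rho>: "(\<rho> s)\<^sup>2 * \<beta> s = \<alpha> s"
      using pos[OF s] by (simp add: powr_minus)
    have RQ: "?R (Q s) = P s" "?R (P s) = Q s" by (simp_all add: Q_def)
    have Rx: "?R (x s) = (1 / 2) *\<^sub>R (P s + Q s) - (\<rho> s / 2) *\<^sub>R (P s - Q s)"
      unfolding x_def twist_refl_linear_simps RQ by (simp add: algebra_simps)
    \<comment> \<open>The quadratic form is the difference of the squared lengths of the two
      eigencomponents.\<close>
    have "x s \<bullet> ?R (x s) = (1 / 4) * ((P s + Q s) \<bullet> (P s + Q s)) - ((\<rho> s)\<^sup>2 / 4) * ((P s - Q s) \<bullet> (P s - Q s))"
    proof -
      have "(v + w) \<bullet> (v - w) = v \<bullet> v - w \<bullet> w" for v w :: "'a \<times> 'a"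
        by (simp add: inner_add_left inner_diff_right inner_commute[of w v])
      from this[of "(1 / 2) *\<^sub>R (P s + Q s)" "(\<rho> s / 2) *\<^sub>R (P s - Q s)"] show ?thesis
        unfolding Rx unfolding x_def by (simp add: power2_eq_square)
    qed
    also have "(P s + Q s) \<bullet> (P s + Q s) = 2 * \<alpha> s"
      by (simp add: \<alpha>_def inner_add_left inner_add_right QQ inner_commute[of "Q s" "P s"])
    also have "(P s - Q s) \<bullet> (P s - Q s) = 2 * \<beta> s"
      by (simp add: \<beta>_def inner_diff_left inner_diff_right QQ inner_commute[of "Q s" "P s"])
    finally have 1: "x s \<bullet> ?R (x s) = 0" using \<rho> by (simp add: mult.commute)
    have "x s \<noteq> 0"
    proof
      assume 0: "x s = 0"
      \<comment> \<open>Adding \<open>x s\<close> and its reflection doubles the fixed component and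
        gives \<open>P s + Q s\<close>, which is nonzero while
        \<open>\<alpha> s > 0\<close>.\<close>
      have "(1 / 2) *\<^sub>R v + w + ((1 / 2) *\<^sub>R v - w) = v" for v w :: "'a \<times> 'a"
        by (simp flip: scaleR_add_left)
      then have "P s + Q s = x s + ?R (x s)"
        unfolding Rx unfolding x_def by simp
      then have "P s + Q s = 0"
        using 0 by (simp add: twist_refl_linear_simps)
      then have "Q s = - P s" by (simp add: eq_neg_iff_add_eq_0 add.commute)
      then show False using pos[OF s] by (simp add: \<alpha>_def)
    qed
    with 1 show ?thesis by (simp add: \<gamma>_def helicoid_def)
  qed
  \<comment> \<open>Tangency says that \<open>P s \<bullet> Q s\<close> has derivative zero at
    \<open>0\<close>. So \<open>\<alpha>\<close> and \<open>\<beta>\<close> agree to first order,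
    and \<open>\<rho>\<close> has derivative zero.\<close>
  have d\<alpha>: "(\<alpha> has_real_derivative 2 * (q \<bullet> u)) (at 0)" and d\<beta>: "(\<beta> has_real_derivative 2 * (q \<bullet> u)) (at 0)"
  proof -
    have t: "u \<bullet> twist_refl (2 * c * t) q + c * \<tau> * (q \<bullet> twist_refl (2 * c * t + pi / 2) q) = 0"
      using tangent by (simp add: conormal_inner slant_def mult_ac)
    have u: "q \<bullet> twist_refl (2 * c * t) u = u \<bullet> twist_refl (2 * c * t) q"
      by (rule twist_refl_inner_swap)
    have "((\<lambda>s. P s \<bullet> Q s) has_derivative (\<lambda>h. q \<bullet> (h *\<^sub>R twist_refl (2 * c * t) u
        + (2 * c * (h * \<tau>)) *\<^sub>R twist_refl (2 * c * t + pi / 2) q)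
        + h *\<^sub>R u \<bullet> twist_refl (2 * c * t) q)) (at 0)"
      unfolding P_def Q_def
      by (rule derivative_eq_intros refl)+ (simp add: twist_refl_linear_simps)
    moreover have "q \<bullet> (h *\<^sub>R twist_refl (2 * c * t) u + (2 * c * (h * \<tau>)) *\<^sub>R twist_refl (2 * c * t + pi / 2) q)
        + h *\<^sub>R u \<bullet> twist_refl (2 * c * t) q =
        2 * h * (u \<bullet> twist_refl (2 * c * t) q + c * \<tau> * (q \<bullet> twist_refl (2 * c * t + pi / 2) q))" for h
      unfolding inner_add_right inner_scaleR_right inner_scaleR_left u by (simp add: algebra_simps)
    ultimately have PQ: "((\<lambda>s. P s \<bullet> Q s) has_derivative (\<lambda>h. h * 0)) (at 0)"
      unfolding t by simp
    have PP: "((\<lambda>s. P s \<bullet> P s) has_derivative (\<lambda>h. h * (2 * (q \<bullet> u)))) (at 0)"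
      unfolding P_def
      by (rule derivative_eq_intros refl)+ (simp add: fun_eq_iff inner_commute)
    show "(\<alpha> has_real_derivative 2 * (q \<bullet> u)) (at 0)"
      unfolding \<alpha>_def has_field_derivative_def
      by (rule has_derivative_eq_rhs[OF has_derivative_add[OF PP PQ]]) auto
    show "(\<beta> has_real_derivative 2 * (q \<bullet> u)) (at 0)"
      unfolding \<beta>_def has_field_derivative_def
      by (rule has_derivative_eq_rhs[OF has_derivative_diff[OF PP PQ]]) auto
  qed
  have d1: "((\<lambda>s. \<alpha> s powr (1 / 2)) has_real_derivative (1 / 2) * m powr (- 1 / 2) * (2 * (q \<bullet> u))) (at 0)"
    using DERIV_fun_powr[OF d\<alpha>, of "1 / 2"] m by simp
  have d2: "((\<lambda>s. \<beta> s powr (- 1 / 2)) has_real_derivative (- 1 / 2) * m powr (- 3 / 2) * (2 * (q \<bullet> u))) (at 0)"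
    using DERIV_fun_powr[OF d\<beta>, of "- 1 / 2"] m by simp
  have "(\<rho> has_real_derivative (1 / 2) * m powr (- 1 / 2) * (2 * (q \<bullet> u)) * m powr (- 1 / 2)
      + (- 1 / 2) * m powr (- 3 / 2) * (2 * (q \<bullet> u)) * m powr (1 / 2)) (at 0)"
    unfolding \<rho>_def using DERIV_mult[OF d1 d2] by (simp only: m)
  moreover have "m powr (- 1 / 2) * m powr (- 1 / 2) = m powr (- 3 / 2) * m powr (1 / 2)"
    by (simp add: powr_add[symmetric])
  ultimately have d\<rho>: "(\<rho> has_real_derivative 0) (at 0)"
    by (simp add: algebra_simps)
  have \<rho>0: "\<rho> 0 = 1"
    using m by (simp add: \<rho>_def powr_add[symmetric])
  have "Q differentiable (at 0)"
    using smQ unfolding smooth_on_def by (metis Ck_on.simps(2) UNIV_I)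
  then obtain Q' where Q': "(Q has_derivative Q') (at 0)" by (auto simp: differentiable_def)
  have P': "(P has_derivative (\<lambda>h. h *\<^sub>R u)) (at 0)"
    unfolding P_def by (auto intro!: derivative_eq_intros)
  \<comment> \<open>In this form the correction to the straight line has a coefficient that vanishes
    at \<open>0\<close> together with its derivative, so the velocity is that of
    \<open>P\<close>.\<close>
  have "x = (\<lambda>s. P s + ((\<rho> s - 1) / 2) *\<^sub>R (P s - Q s))"
    by (simp add: fun_eq_iff x_def algebra_simps diff_divide_distrib flip: scaleR_add_left)
  moreover have "((\<lambda>s. P s + ((\<rho> s - 1) / 2) *\<^sub>R (P s - Q s)) has_derivative (\<lambda>h. h *\<^sub>R u)) (at 0)"
    using d\<rho>[unfolded has_field_derivative_def]
    by (auto intro!: derivative_eq_intros P' Q' simp: \<rho>0)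
  ultimately have "(x has_derivative (\<lambda>h. h *\<^sub>R u)) (at 0)" by simp
  then have "(\<gamma> has_vector_derivative (u, \<tau>)) (at 0)"
    unfolding \<gamma>_def has_vector_derivative_def by (auto intro!: derivative_eq_intros)
  moreover have "\<gamma> 0 = (q, t)"
    by (simp add: \<gamma>_def x_def \<rho>0 P0 flip: scaleR_add_left) (simp add: algebra_simps flip: scaleR_add_left)
  moreover have "\<gamma> ` {-e<..<e} \<subseteq> helicoid c" using on by blast
  moreover have "snd (\<gamma> s) = t + s * \<tau>" for s by (simp add: \<gamma>_def)
  ultimately show thesis
    using that[OF e(1) smooth] by blast
qed

lemma has_derivative_quadratic:
  "((\<lambda>p. fst p \<bullet> twist_refl (2 * c * snd p) (fst p) / 2) has_derivative (\<lambda>X. X \<bullet> conormal 1 c p)) (at p)"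
proof -
  have "((\<lambda>p. fst p \<bullet> twist_refl (2 * c * snd p) (fst p) / 2) has_derivative (\<lambda>X.
      (fst p \<bullet> (twist_refl (2 * c * snd p) (fst X) + (2 * c * snd X) *\<^sub>R twist_refl (2 * c * snd p + pi / 2) (fst p))
      + fst X \<bullet> twist_refl (2 * c * snd p) (fst p)) / 2)) (at p)"
    by (rule derivative_eq_intros refl)+ (auto simp: fun_eq_iff)
  moreover have "(fst p \<bullet> (twist_refl (2 * c * snd p) (fst X) + (2 * c * snd X) *\<^sub>R twist_refl (2 * c * snd p + pi / 2) (fst p))
      + fst X \<bullet> twist_refl (2 * c * snd p) (fst p)) / 2 = X \<bullet> conormal 1 c p" for X
    using twist_refl_inner_swap[of "fst p" "2 * c * snd p" "fst X"]
    by (simp add: inner_add_right conormal_inner slant_def)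
  ultimately show ?thesis by simp
qed

text \<open>The defining function gives one inclusion; the curves of \<open>helicoid_curve\<close>
  realise every vector of the hyperplane.\<close>

lemma tangent_space_helicoid:
  assumes "p \<in> helicoid c"
  shows "tangent_space (helicoid c) p = {X. X \<bullet> conormal 1 c p = 0}"
proof
  show "tangent_space (helicoid c) p \<subseteq> {X. X \<bullet> conormal 1 c p = 0}"
    using tangent_space_subset_kernel[OF _ has_derivative_quadratic assms]
    by (auto simp: helicoid_def)
  show "{X. X \<bullet> conormal 1 c p = 0} \<subseteq> tangent_space (helicoid c) p"
  proof
    fix X assume "X \<in> {X. X \<bullet> conormal 1 c p = 0}"
    then have tangent: "(fst X, snd X) \<bullet> conormal 1 c (fst p, snd p) = 0" by simp
    have "(fst p, snd p) \<in> helicoid c" using assms by simp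
    then obtain \<gamma> e where "e > 0" "smooth_on {-e<..<e} \<gamma>" "\<gamma> ` {-e<..<e} \<subseteq> helicoid c"
      "\<gamma> 0 = (fst p, snd p)" "(\<gamma> has_vector_derivative (fst X, snd X)) (at 0)"
      "\<And>s. snd (\<gamma> s) = snd p + s * snd X"
      using tangent that by (rule helicoid_curve)
    then show "X \<in> tangent_space (helicoid c) p"
      unfolding tangent_space_def prod.collapse by blast
  qed
qed

lemma has_derivative_quadratic_section:
  "((\<lambda>q. q \<bullet> twist_refl \<theta> q) has_derivative (\<lambda>u. 2 * (u \<bullet> twist_refl \<theta> q))) (at q)"
proof -
  have "((\<lambda>q. q \<bullet> twist_refl \<theta> q) has_derivative
      (\<lambda>u. q \<bullet> twist_refl \<theta> u + u \<bullet> twist_refl \<theta> q)) (at q)"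
    by (rule derivative_eq_intros refl)+ simp
  moreover have "q \<bullet> twist_refl \<theta> u + u \<bullet> twist_refl \<theta> q = 2 * (u \<bullet> twist_refl \<theta> q)" for u
    using twist_refl_inner_swap[of q \<theta> u] by simp
  ultimately show ?thesis by simp
qed

text \<open>For the velocity \<open>(u, 0)\<close> the curve of \<open>helicoid_curve\<close> keeps
  its height exactly, so its first component runs inside the section.\<close>

lemma tangent_space_section:
  assumes "(q, t) \<in> helicoid c"
  shows "tangent_space (horizontal_section (helicoid c) t) q = {u. u \<bullet> twist_refl (2 * c * t) q = 0}"
proof
  show "tangent_space (horizontal_section (helicoid c) t) q \<subseteq> {u. u \<bullet> twist_refl (2 * c * t) q = 0}"
  proof
    fix u assume u: "u \<in> tangent_space (horizontal_section (helicoid c) t) q"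
    have "2 * (u \<bullet> twist_refl (2 * c * t) q) = 0"
      by (rule tangent_space_subset_kernel[OF u has_derivative_quadratic_section])
        (use assms in \<open>simp_all add: horizontal_section_def helicoid_def\<close>)
    then show "u \<in> {u. u \<bullet> twist_refl (2 * c * t) q = 0}" by simp
  qed
  show "{u. u \<bullet> twist_refl (2 * c * t) q = 0} \<subseteq> tangent_space (horizontal_section (helicoid c) t) q"
  proof
    fix u assume u: "u \<in> {u. u \<bullet> twist_refl (2 * c * t) q = 0}"
    then have "(u, 0) \<bullet> conormal 1 c (q, t) = 0" by (simp add: conormal_inner)
    with assms obtain \<gamma> e where \<gamma>: "e > 0" "smooth_on {-e<..<e} \<gamma>" "\<gamma> ` {-e<..<e} \<subseteq> helicoid c"
      "\<gamma> 0 = (q, t)" "(\<gamma> has_vector_derivative (u, 0)) (at 0)" "\<And>s. snd (\<gamma> s) = t + s * 0"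
      using that by (rule helicoid_curve)
    have "fst (\<gamma> s) \<in> horizontal_section (helicoid c) t" if "s \<in> {-e<..<e}" for s
    proof -
      have "\<gamma> s \<in> helicoid c" using that \<gamma>(3) by blast
      moreover have "\<gamma> s = (fst (\<gamma> s), t)" using \<gamma>(6)[of s] by (simp add: prod_eq_iff)
      ultimately show ?thesis unfolding horizontal_section_def by (metis mem_Collect_eq)
    qed
    moreover have "((\<lambda>s. fst (\<gamma> s)) has_vector_derivative u) (at 0)"
      using bounded_linear.has_vector_derivative[OF bounded_linear_fst \<gamma>(5)] by simp
    moreover have "smooth_on {-e<..<e} (\<lambda>s. fst (\<gamma> s))"
      by (intro smooth_intros \<gamma>) auto
    ultimately show "u \<in> tangent_space (horizontal_section (helicoid c) t) q"
      unfolding tangent_space_def using \<gamma>(1,4) by (auto intro!: exI[of _ "\<lambda>s. fst (\<gamma> s)"] exI[of _ e])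
  qed
qed

section \<open>The twisted cone as a level set\<close>

text \<open>Multiplication of \<open>z = x + i y\<close> by the complex exponential of
  \<open>i \<theta>\<close>.\<close>

definition rot :: "real \<Rightarrow> 'a::euclidean_space \<times> 'a \<Rightarrow> 'a \<times> 'a" where
  "rot \<theta> p = (cos \<theta> *\<^sub>R fst p - sin \<theta> *\<^sub>R snd p, sin \<theta> *\<^sub>R fst p + cos \<theta> *\<^sub>R snd p)"

lemma rot_rot: "rot \<theta> (rot \<eta> p) = rot (\<theta> + \<eta>) p"
  by (simp add: rot_def sin_add cos_add algebra_simps)

lemma rot_0 [simp]: "rot 0 p = p" "rot \<theta> 0 = 0"
  by (simp_all add: rot_def zero_prod_def)

lemma rot_eq_0_iff [simp]: "rot \<theta> p = 0 \<longleftrightarrow> p = 0"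
  using rot_rot[of "- \<theta>" \<theta> p] by auto

lemma rot_inner_rot [simp]: "rot \<theta> p \<bullet> rot \<theta> q = p \<bullet> q"
proof -
  have "rot \<theta> p \<bullet> rot \<theta> q = ((cos \<theta>)\<^sup>2 + (sin \<theta>)\<^sup>2) * (fst p \<bullet> fst q + snd p \<bullet> snd q)"
    unfolding rot_def inner_prod_def fst_conv snd_conv inner_add_left inner_add_right inner_diff_left
      inner_diff_right inner_scaleR_left inner_scaleR_right
    by algebra
  then show ?thesis by (simp add: inner_prod_def)
qed

text \<open>Conjugation reverses the rotation by \<open>\<theta>\<close>, and the factor of angle
  \<open>2 * \<theta>\<close> turns it back to \<open>\<theta>\<close>. This is why the reflection
  moves at twice the speed of the cone.\<close>

lemma twist_refl_rot: "twist_refl (2 * \<theta>) (rot \<theta> p) = rot \<theta> (fst p, - snd p)"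
proof -
  have "a *\<^sub>R (d *\<^sub>R x - s *\<^sub>R y) + b *\<^sub>R (s *\<^sub>R x + d *\<^sub>R y) = (a * d + b * s) *\<^sub>R x + (b * d - a * s) *\<^sub>R y"
    "b *\<^sub>R (d *\<^sub>R x - s *\<^sub>R y) - a *\<^sub>R (s *\<^sub>R x + d *\<^sub>R y) = (b * d - a * s) *\<^sub>R x - (a * d + b * s) *\<^sub>R y"
    for a b d s and x y :: 'a
    by (simp_all add: algebra_simps)
  moreover have "cos (2 * \<theta>) * cos \<theta> + sin (2 * \<theta>) * sin \<theta> = cos \<theta>"
    "sin (2 * \<theta>) * cos \<theta> - cos (2 * \<theta>) * sin \<theta> = sin \<theta>"
    using cos_diff[of "2 * \<theta>" \<theta>] sin_diff[of "2 * \<theta>" \<theta>] by simp_all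
  ultimately show ?thesis
    by (simp add: twist_refl_def rot_def)
qed

lemma exp_map_J_map: "exp_map (\<lambda>v. \<theta> *\<^sub>R J_map v) p = rot \<theta> p"
proof -
  let ?L = "\<lambda>v. \<theta> *\<^sub>R J_map v"
  \<comment> \<open>Since \<open>J_map\<close> squares to minus the identity, even powers give the
    cosine series and odd ones the sine series. Both coefficients vanish in the wrong parity, so one
    formula covers all \<open>j\<close>.\<close>
  have "(1 / fact j) *\<^sub>R (?L ^^ j) p = (cos_coeff j *\<^sub>R \<theta> ^ j) *\<^sub>R p + (sin_coeff j *\<^sub>R \<theta> ^ j) *\<^sub>R J_map p" for j
  proof (induction j)
    case (Suc j)
    have J: "J_map (a *\<^sub>R v + b *\<^sub>R w) = a *\<^sub>R J_map v + b *\<^sub>R J_map w" "J_map (J_map v) = - v"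
      for a b v w by (simp_all add: J_map_def prod_eq_iff)
    have "(1 / fact (Suc j)) *\<^sub>R (?L ^^ Suc j) p = (\<theta> / Suc j) *\<^sub>R J_map ((1 / fact j) *\<^sub>R (?L ^^ j) p)"
      using J(1)[of "1 / fact j" "(?L ^^ j) p" 0 0] by (simp add: field_simps)
    also have "\<dots> = (\<theta> / Suc j) *\<^sub>R ((cos_coeff j *\<^sub>R \<theta> ^ j) *\<^sub>R J_map p + (sin_coeff j *\<^sub>R \<theta> ^ j) *\<^sub>R (- p))"
      by (simp only: Suc J)
    also have "\<dots> = (cos_coeff (Suc j) *\<^sub>R \<theta> ^ Suc j) *\<^sub>R p + (sin_coeff (Suc j) *\<^sub>R \<theta> ^ Suc j) *\<^sub>R J_map p"
      by (simp add: cos_coeff_Suc sin_coeff_Suc scaleR_diff_right mult_ac)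
    finally show ?case .
  qed simp
  moreover have "(\<lambda>j. (cos_coeff j *\<^sub>R \<theta> ^ j) *\<^sub>R p + (sin_coeff j *\<^sub>R \<theta> ^ j) *\<^sub>R J_map p) sums
      (cos \<theta> *\<^sub>R p + sin \<theta> *\<^sub>R J_map p)"
    by (intro sums_add sums_scaleR_left cos_converges sin_converges)
  ultimately have "exp_map ?L p = cos \<theta> *\<^sub>R p + sin \<theta> *\<^sub>R J_map p"
    unfolding exp_map_def by (simp add: sums_iff)
  then show ?thesis
    by (simp add: rot_def J_map_def prod_eq_iff)
qed

lemma cone_over_clifford_torus: "cone_over clifford_torus = {p. p \<noteq> 0 \<and> norm (fst p) = norm (snd p)}"
proof (intro set_eqI iffI)
  fix p :: "(real^'n) \<times> (real^'n)" assume "p \<in> cone_over clifford_torus"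
  then show "p \<in> {p. p \<noteq> 0 \<and> norm (fst p) = norm (snd p)}"
    by (auto simp: cone_over_def clifford_torus_def prod_eq_iff)
next
  fix p :: "(real^'n) \<times> (real^'n)" assume p: "p \<in> {p. p \<noteq> 0 \<and> norm (fst p) = norm (snd p)}"
  \<comment> \<open>Both components of a torus point have norm \<open>1 / sqrt 2\<close>, which
    forces this radius.\<close>
  define r where "r = sqrt 2 * norm (fst p)"
  have "fst p \<noteq> 0" using p by (auto simp: prod_eq_iff)
  then have r: "r > 0" by (simp add: r_def)
  have "(1 / r) *\<^sub>R p \<in> clifford_torus"
    using p r by (cases p) (auto simp: clifford_torus_def r_def)
  moreover have "p = r *\<^sub>R (1 / r) *\<^sub>R p" using r by simp
  ultimately show "p \<in> cone_over clifford_torus"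
    unfolding cone_over_def using r by blast
qed

text \<open>Undoing the rotation turns the quadratic form into the difference of the squared norms
  of the components of \<open>p\<close>.\<close>

lemma rot_mem_helicoid_iff:
  assumes "c * t = \<theta>"
  shows "(rot \<theta> p, t) \<in> helicoid c \<longleftrightarrow> p \<noteq> 0 \<and> norm (fst p) = norm (snd p)"
proof -
  have "rot \<theta> p \<bullet> twist_refl (2 * c * t) (rot \<theta> p) = p \<bullet> (fst p, - snd p)"
    using assms by (simp add: twist_refl_rot mult.assoc)
  also have "\<dots> = (norm (fst p))\<^sup>2 - (norm (snd p))\<^sup>2"
    by (simp add: inner_prod_def power2_norm_eq_inner)
  finally show ?thesis by (simp add: helicoid_def)
qed

text \<open>At height \<open>t = a * s\<close> the rotation angle is
  \<open>k * s = (k / a) * t\<close>, so only the quotient enters.\<close>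

lemma twisting_eq_helicoid:
  assumes "a \<noteq> 0"
  shows "twisting a k = helicoid (k / a)"
proof (intro set_eqI iffI)
  fix z :: "((real^'n) \<times> (real^'n)) \<times> real" assume "z \<in> twisting a k"
  then show "z \<in> helicoid (k / a)"
    using assms by (auto simp: twisting_def exp_map_J_map rot_mem_helicoid_iff cone_over_clifford_torus)
next
  fix z :: "((real^'n) \<times> (real^'n)) \<times> real" assume z: "z \<in> helicoid (k / a)"
  \<comment> \<open>The height determines \<open>s\<close>, and rotating back recovers the point of
    the cone.\<close>
  define s where "s = snd z / a"
  define p where "p = rot (- (k * s)) (fst z)"
  have z': "z = (rot (k * s) p, a * s)"
    using assms by (simp add: p_def rot_rot s_def)
  then have "p \<in> cone_over clifford_torus"
    using z rot_mem_helicoid_iff[of "k / a" "a * s" "k * s" p] assms by (simp add: cone_over_clifford_torus)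
  then show "z \<in> twisting a k"
    unfolding twisting_def exp_map_J_map using z' by blast
qed

section \<open>Curvature\<close>

lemma open_sqnorm_pos: "open {p. sqnorm \<epsilon> c p > 0}"
  and smooth_on_normal: "smooth_on {p. sqnorm \<epsilon> c p > 0} (normal \<epsilon> c)"
proof -
  have slant: "smooth_on UNIV (slant c)" unfolding slant_def by (intro smooth_intros) auto
  have sq: "smooth_on UNIV (sqnorm \<epsilon> c)"
    unfolding sqnorm_def power2_eq_square by (intro smooth_intros slant) auto
  have con: "smooth_on UNIV (conormal \<epsilon> c)"
    unfolding conormal_def by (intro smooth_intros slant) auto
  show op: "open {p. sqnorm \<epsilon> c p > 0}"
    using smooth_on_imp_continuous_on[OF sq] by (intro open_Collect_less) auto
  show "smooth_on {p. sqnorm \<epsilon> c p > 0} (normal \<epsilon> c)"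
    unfolding normal_def
    by (intro smooth_intros smooth_on_mono[OF sq] smooth_on_mono[OF con] op) auto
qed

lemma sqnorm_pos: "p \<in> helicoid c \<Longrightarrow> sqnorm 1 c p > 0"
  unfolding sqnorm_def by (rule add_nonneg_pos) (auto simp: helicoid_def simp del: inner_Pair)

lemma conormal_inner_self: "conormal 1 c p \<bullet> conormal 1 c p = sqnorm 1 c p"
  by (simp add: conormal_inner) (simp add: sqnorm_def conormal_def power2_eq_square mult_ac)

lemma conormal_nonzero: "p \<in> helicoid c \<Longrightarrow> conormal 1 c p \<noteq> 0"
  using sqnorm_pos[of p c] conormal_inner_self[of c p] by auto

text \<open>Off the axis one quadratic function defines the whole piece, with gradient
  \<open>conormal 1 c\<close>. The open set \<open>V\<close> allows both the full helicoid and its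
  spacelike part.\<close>

lemma embedded_hypersurface_helicoid:
  assumes "open V"
  shows "embedded_hypersurface (helicoid c \<inter> V)"
  unfolding embedded_hypersurface_def
proof (intro ballI exI conjI)
  let ?U = "{p. fst p \<noteq> 0} \<inter> V" and ?g = "\<lambda>p. fst p \<bullet> twist_refl (2 * c * snd p) (fst p) / 2"
  show op: "open ?U"
    using assms by (intro open_Int open_Collect_neq) (auto intro!: continuous_intros)
  show "smooth_on ?U ?g"
    unfolding divide_inverse using op by (intro smooth_intros)
  show "(helicoid c \<inter> V) \<inter> ?U = {x \<in> ?U. ?g x = 0}"
    by (auto simp: helicoid_def)
  fix p assume p: "p \<in> helicoid c \<inter> V"
  then show "p \<in> ?U" by (auto simp: helicoid_def)
  show "frechet_derivative ?g (at x) \<noteq> (\<lambda>_. 0)" if "x \<in> (helicoid c \<inter> V) \<inter> ?U" for x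
  proof -
    have "frechet_derivative ?g (at x) = (\<lambda>X. X \<bullet> conormal 1 c x)"
      by (rule frechet_derivative_at[OF has_derivative_quadratic, symmetric])
    then show ?thesis
      using conormal_nonzero[of x c] that by (metis IntD1 inner_eq_zero_iff)
  qed
qed

lemma tangent_space_helicoid_Int:
  "p \<in> helicoid c \<inter> V \<Longrightarrow> open V \<Longrightarrow> tangent_space (helicoid c \<inter> V) p = {X. X \<bullet> conormal 1 c p = 0}"
  by (simp add: tangent_space_Int_open tangent_space_helicoid)

lemma unit_normal_field_normal:
  assumes "open V"
  shows "unit_normal_field (helicoid c \<inter> V) (normal 1 c)"
  unfolding unit_normal_field_def smooth_on_subset_def
proof (intro conjI ballI)
  fix p assume p: "p \<in> helicoid c \<inter> V"
  then have pos: "sqnorm 1 c p > 0" by (auto intro: sqnorm_pos)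
  show "\<exists>U F. open U \<and> p \<in> U \<and> smooth_on U F \<and> (\<forall>x\<in>helicoid c \<inter> V \<inter> U. F x = normal 1 c x)"
    using pos open_sqnorm_pos smooth_on_normal by blast
  have "(norm (normal 1 c p))\<^sup>2 = (sqnorm 1 c p powr (- 1 / 2))\<^sup>2 * sqnorm 1 c p"
    by (simp add: normal_def power_mult_distrib power2_norm_eq_inner[of "conormal 1 c p"] conormal_inner_self)
  also have "\<dots> = 1"
    unfolding powr_neg_half_squared[OF pos] using pos by simp
  finally show "norm (normal 1 c p) = 1"
    by (simp only: abs_square_eq_1 abs_norm_cancel)
  show "normal 1 c p \<bullet> X = 0" if "X \<in> tangent_space (helicoid c \<inter> V) p" for X
    using that tangent_space_helicoid_Int[OF p assms]
    by (simp add: normal_def inner_commute[of _ X])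
qed

text \<open>Only the values of \<open>N\<close> on the surface matter, so
  \<open>lorentz_normal\<close> may be replaced by \<open>normal (-1) c\<close>, with which it
  agrees on the spacelike part.\<close>

lemma shape_operator_eq:
  assumes "p \<in> helicoid c \<inter> V" "sqnorm \<epsilon> c p > 0"
    and "\<And>x. x \<in> helicoid c \<inter> V \<Longrightarrow> N x = normal \<epsilon> c x" and "X \<in> tangent_space (helicoid c \<inter> V) p"
  shows "shape_operator (helicoid c \<inter> V) N p X = - normal_deriv \<epsilon> c p X"
proof -
  have "(N has_derivative normal_deriv \<epsilon> c p) (at p within helicoid c \<inter> V)"
    using assms(1,2)
    by (intro has_derivative_transform[OF assms(1,3) has_derivative_at_withinI[OF has_derivative_normal]]) auto
  from deriv_along_eq[OF assms(4) this] show ?thesis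
    by (simp add: shape_operator_def)
qed

text \<open>The derivative of the normal is tangential and has ambient trace zero, so its trace on
  the tangent hyperplane is zero. The two signs of \<open>\<epsilon>\<close> serve the Riemannian
  and the Lorentzian mean curvature.\<close>

lemma trace_shape_operator:
  assumes "open V" "p \<in> helicoid c \<inter> V" "sqnorm \<epsilon> c p > 0" "\<epsilon>\<^sup>2 = 1"
    and "\<And>x. x \<in> helicoid c \<inter> V \<Longrightarrow> N x = normal \<epsilon> c x"
  shows "trace_on (tangent_space (helicoid c \<inter> V) p) (shape_operator (helicoid c \<inter> V) N p) = 0"
proof -
  have "trace_on (tangent_space (helicoid c \<inter> V) p) (shape_operator (helicoid c \<inter> V) N p)
      = (\<Sum>e\<in>Basis. - normal_deriv \<epsilon> c p e \<bullet> e)"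
  proof (rule trace_on_hyperplane)
    show "linear (\<lambda>X. - normal_deriv \<epsilon> c p X)"
      by (intro linear_compose_neg linear_normal_deriv)
    show "tangent_space (helicoid c \<inter> V) p = {X. X \<bullet> conormal 1 c p = 0}"
      using assms by (intro tangent_space_helicoid_Int)
    show "conormal 1 c p \<noteq> 0" using assms(2) conormal_nonzero by blast
    show "- normal_deriv \<epsilon> c p X \<bullet> conormal 1 c p = 0" for X
      using normal_deriv_tangential[OF assms(3,4)] by simp
  qed (rule shape_operator_eq[OF assms(2,3,5)])
  then show ?thesis
    using trace_normal_deriv[of p c \<epsilon>] assms(2) by (simp add: sum_negf)
qed

text \<open>The gradient of the height is the vertical unit vector minus its component along the
  conormal; \<open>sqnorm 1 c p - (c * slant c p)\<^sup>2\<close> is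
  \<open>fst p \<bullet> fst p\<close>.\<close>

lemma gradient_on_snd:
  assumes "p \<in> helicoid c"
  shows "gradient_on (helicoid c) snd p =
    ((- (1 / sqnorm 1 c p) * c * slant c p) *\<^sub>R twist_refl (2 * c * snd p) (fst p), 1 / sqnorm 1 c p * (fst p \<bullet> fst p))"
    (is "_ = ?v")
proof -
  let ?T = "tangent_space (helicoid c) p"
  note T = tangent_space_helicoid[OF assms]
  have pos: "sqnorm 1 c p > 0" using assms by (rule sqnorm_pos)
  have d: "deriv_along (helicoid c) snd p X = snd X" if "X \<in> ?T" for X
    by (rule deriv_along_eq[OF that]) (auto intro!: derivative_eq_intros)
  have v: "?v \<in> ?T"
    by (simp add: T conormal_inner)
  have g: "?v \<bullet> X = snd X" if "X \<in> ?T" for X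
  proof -
    have "twist_refl (2 * c * snd p) (fst p) \<bullet> fst X = - (c * slant c p * snd X)"
      using that by (simp add: T conormal_inner inner_commute)
    then have "?v \<bullet> X = (- (1 / sqnorm 1 c p) * c * slant c p) * (- (c * slant c p * snd X))
        + 1 / sqnorm 1 c p * (fst p \<bullet> fst p) * snd X"
      unfolding inner_prod_def[of ?v] fst_conv snd_conv inner_scaleR_left inner_real_def by (simp only:)
    moreover have "(- i * c * w) * (- (c * w * x)) + i * r * x = i * (((c * w)\<^sup>2 + 1 * r) * x)" for i w x r :: real
      by algebra
    ultimately have "?v \<bullet> X = 1 / sqnorm 1 c p * (sqnorm 1 c p * snd X)"
      unfolding sqnorm_def by (simp only:)
    then show ?thesis using pos by simp
  qed
  show ?thesis
    unfolding gradient_on_def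
  proof (rule the_equality)
    show "?v \<in> ?T \<and> (\<forall>X\<in>?T. ?v \<bullet> X = deriv_along (helicoid c) snd p X)"
      using v g d by simp
    fix w assume w: "w \<in> ?T \<and> (\<forall>X\<in>?T. w \<bullet> X = deriv_along (helicoid c) snd p X)"
    \<comment> \<open>Two gradients differ by a tangent vector that is orthogonal to itself.\<close>
    then have "w - ?v \<in> ?T" using v unfolding T by (simp add: inner_diff_left)
    then have "(w - ?v) \<bullet> (w - ?v) = 0"
      using w g[of "w - ?v"] d[of "w - ?v"] unfolding inner_diff_left[of w ?v] by auto
    then show "w = ?v" by simp
  qed
qed

section \<open>Angle function and minimality of the sections\<close>

lemma angle_function_normal: "angle_function (normal 1 c) p = sqnorm 1 c p powr (- 1 / 2) * (c * slant c p)"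
  by (simp add: angle_function_def vertical_field_def normal_def conormal_def inner_prod_def)

lemma angle_function_normal_sq:
  assumes "p \<in> helicoid c"
  shows "(angle_function (normal 1 c) p)\<^sup>2 = (c * slant c p)\<^sup>2 / sqnorm 1 c p"
proof -
  have "(sqnorm 1 c p powr (- 1 / 2))\<^sup>2 = 1 / sqnorm 1 c p"
    using sqnorm_pos[OF assms] by (rule powr_neg_half_squared)
  then show ?thesis
    by (simp add: angle_function_normal power_mult_distrib[of "_ powr _"])
qed

text \<open>The section is a quadratic cone with unit normal \<open>R q\<close> divided by the norm
  of \<open>q\<close>. Minimality again follows from the zero trace of the reflection and the
  equation \<open>q \<bullet> R q = 0\<close>.\<close>

lemma minimal_section:
  "minimal_hypersurface (horizontal_section (helicoid c :: (('a::euclidean_space \<times> 'a) \<times> real) set) t)"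
proof -
  let ?S = "horizontal_section (helicoid c :: (('a \<times> 'a) \<times> real) set) t" and ?R = "twist_refl (2 * c * t)"
  let ?U = "{q :: 'a \<times> 'a. q \<noteq> 0}" and ?g = "\<lambda>q :: 'a \<times> 'a. q \<bullet> ?R q"
  let ?N = "\<lambda>q :: 'a \<times> 'a. ((q \<bullet> q) powr (- 1 / 2)) *\<^sub>R ?R q"
  have S: "q \<in> ?S \<longleftrightarrow> q \<noteq> 0 \<and> q \<bullet> ?R q = 0" for q
    by (simp add: horizontal_section_def helicoid_def)
  have T: "tangent_space ?S q = {u. u \<bullet> ?R q = 0}" if "q \<in> ?S" for q
    using tangent_space_section[of q t c] that by (simp add: horizontal_section_def)
  have opU: "open ?U" by (intro open_Collect_neq) (auto intro!: continuous_intros)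
  have d: "(?g has_derivative (\<lambda>u. 2 * (u \<bullet> ?R q))) (at q)" for q :: "'a \<times> 'a"
    by (rule has_derivative_quadratic_section)
  have "embedded_hypersurface ?S"
    unfolding embedded_hypersurface_def
  proof (intro ballI exI conjI)
    show "open ?U" by (rule opU)
    show "smooth_on ?U ?g" using opU by (intro smooth_intros)
    show "?S \<inter> ?U = {x \<in> ?U. ?g x = 0}" by (auto simp: S)
    show "frechet_derivative ?g (at x) \<noteq> (\<lambda>_. 0)" if "x \<in> ?S \<inter> ?U" for x
    proof
      assume "frechet_derivative ?g (at x) = (\<lambda>_. 0)"
      with frechet_derivative_at[OF d[of x]] have "(\<lambda>u. 2 * (u \<bullet> ?R x)) = (\<lambda>_. 0)"
        by (rule trans)
      from fun_cong[OF this, of "?R x"] show False using that by simp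
    qed
  qed (auto simp: S)
  moreover have "unit_normal_field ?S ?N"
    unfolding unit_normal_field_def smooth_on_subset_def
  proof (intro conjI ballI)
    fix q assume q: "q \<in> ?S"
    have "smooth_on ?U ?N" using opU by (intro smooth_intros) auto
    then show "\<exists>U F. open U \<and> q \<in> U \<and> smooth_on U F \<and> (\<forall>x\<in>?S \<inter> U. F x = ?N x)"
      using opU q S by blast
    have pos: "q \<bullet> q > 0" using q S by simp
    have "(norm (?N q))\<^sup>2 = ((q \<bullet> q) powr (- 1 / 2))\<^sup>2 * (q \<bullet> q)"
      by (simp add: power_mult_distrib power2_norm_eq_inner[of "?R q"])
    also have "\<dots> = 1"
      unfolding powr_neg_half_squared[OF pos] using pos by simp
    finally show "norm (?N q) = 1" by (simp only: abs_square_eq_1 abs_norm_cancel)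
    show "?N q \<bullet> X = 0" if "X \<in> tangent_space ?S q" for X
      using that by (simp add: T[OF q] inner_commute)
  qed
  moreover have "mean_curvature ?S ?N q = 0" if q: "q \<in> ?S" for q
  proof -
    have pos: "q \<bullet> q > 0" using q S by simp
    define D where "D u = ((q \<bullet> q) powr (- 1 / 2)) *\<^sub>R ?R u - ((q \<bullet> q) powr (- 3 / 2) * (q \<bullet> u)) *\<^sub>R ?R q" for u
    have "((\<lambda>y. y powr (- 1 / 2)) has_real_derivative (- 1 / 2) * (q \<bullet> q) powr (- 1 / 2 - 1)) (at (q \<bullet> q))"
      using pos by (rule has_real_derivative_powr)
    then have p: "((\<lambda>y. y powr (- 1 / 2)) has_derivative (\<lambda>h. (- 1 / 2) * (q \<bullet> q) powr (- 3 / 2) * h)) (at (q \<bullet> q))"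
      unfolding has_field_derivative_def by (rule has_derivative_eq_rhs) auto
    have "((\<lambda>q. q \<bullet> q) has_derivative (\<lambda>u. 2 * (q \<bullet> u))) (at q)"
      by (rule derivative_eq_intros refl)+ (simp add: fun_eq_iff inner_commute)
    note pw = has_derivative_compose[OF this p]
    have "bounded_linear ?R" by (simp add: linear_conv_bounded_linear[symmetric] linear_twist_refl)
    then have "(?R has_derivative ?R) (at q)" by (rule bounded_linear_imp_has_derivative)
    from has_derivative_scaleR[OF pw this] have "(?N has_derivative D) (at q)"
      by (rule has_derivative_eq_rhs) (auto simp: D_def fun_eq_iff)
    then have sh: "shape_operator ?S ?N q u = - D u" if "u \<in> tangent_space ?S q" for u
      using deriv_along_eq[OF that has_derivative_at_withinI] by (simp add: shape_operator_def)
    have "trace_on (tangent_space ?S q) (shape_operator ?S ?N q) = (\<Sum>e\<in>Basis. - D e \<bullet> e)"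
    proof (rule trace_on_hyperplane[where G = "?R q"])
      show "linear (\<lambda>u. - D u)"
        by (rule linearI) (simp_all add: D_def twist_refl_linear_simps algebra_simps inner_add_right)
      show "?R q \<noteq> 0" using pos twist_refl_inner_twist_refl[of "2 * c * t" q q] by (metis inner_zero_left less_irrefl)
      show "- D u \<bullet> ?R q = 0" for u
      proof -
        have "D u \<bullet> ?R q = (q \<bullet> q) powr (- 1 / 2) * (u \<bullet> q) - ((q \<bullet> q) powr (- 3 / 2) * (q \<bullet> q)) * (q \<bullet> u)"
          by (simp add: D_def inner_diff_left)
        also have "\<dots> = 0" using pos by (simp only: powr_neg_half_mult) (simp add: inner_commute)
        finally show ?thesis by simp
      qed
      show "tangent_space ?S q = {u. u \<bullet> ?R q = 0}" by (rule T[OF q])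
    qed (rule sh)
    also have "\<dots> = (q \<bullet> q) powr (- 3 / 2) * (\<Sum>e\<in>Basis. (q \<bullet> e) * (?R q \<bullet> e))
        - (q \<bullet> q) powr (- 1 / 2) * (\<Sum>e\<in>(Basis :: ('a \<times> 'a) set). ?R e \<bullet> e)"
      by (simp add: D_def inner_diff_left sum_subtractf sum_distrib_left mult.assoc)
    also have "\<dots> = 0"
      using q S by (simp add: trace_twist_refl euclidean_inner[symmetric])
    finally show ?thesis by (simp add: mean_curvature_def)
  qed
  ultimately show ?thesis
    unfolding minimal_hypersurface_def by blast
qed

section \<open>Verification of the vertical helicoid conditions\<close>

lemma vertical_helicoid_helicoid:
  assumes "c > 0" "DIM('a) \<ge> 2"
  shows "vertical_helicoid (helicoid c :: (('a::euclidean_space \<times> 'a) \<times> real) set)"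
proof -
  let ?S = "helicoid c :: (('a \<times> 'a) \<times> real) set"
  have "embedded_hypersurface ?S" "unit_normal_field ?S (normal 1 c)"
    using embedded_hypersurface_helicoid[of UNIV c] unit_normal_field_normal[of UNIV c] by auto
  moreover have "(angle_function (normal 1 c) p)\<^sup>2 \<noteq> 1" if p: "p \<in> ?S" for p
  proof -
    \<comment> \<open>The gap is \<open>fst p \<bullet> fst p\<close>, positive off the axis, so the
      normal is never vertical.\<close>
    have "(c * slant c p)\<^sup>2 < sqnorm 1 c p"
      using p by (auto simp: sqnorm_def helicoid_def)
    then show ?thesis
      using sqnorm_pos[OF p] by (simp add: angle_function_normal_sq[OF p] divide_eq_1_iff)
  qed
  moreover have "\<not> angle_function (normal 1 c) constant_on ?S"
  proof
    assume *: "angle_function (normal 1 c) constant_on ?S"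
    \<comment> \<open>At height \<open>0\<close> the slant of \<open>(x, y)\<close> is
      \<open>2 * (x \<bullet> y)\<close>. For orthonormal \<open>b\<close> and \<open>b'\<close>,
      the angle is positive at \<open>(b, b)\<close> and zero at \<open>(b, b')\<close>.\<close>
    obtain b b' :: 'a where b: "b \<in> Basis" "b' \<in> Basis" "b \<noteq> b'"
      using assms(2) by (metis card_2_iff' obtain_subset_with_card_n subset_iff)
    have bb: "b \<bullet> b = 1" "b' \<bullet> b' = 1" "b \<bullet> b' = 0" "b' \<bullet> b = 0" "b \<noteq> 0"
      using b by (auto simp: inner_Basis)
    have "((b, b), 0) \<in> ?S" "((b, b'), 0) \<in> ?S"
      using bb by (auto simp: helicoid_def twist_refl_def inner_prod_def zero_prod_def)
    then have "angle_function (normal 1 c) ((b, b), 0) = angle_function (normal 1 c) ((b, b'), 0)"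
      using * unfolding constant_on_def by metis
    moreover have "slant c ((b, b), 0) = 2" "slant c ((b, b'), 0) = 0"
      using bb by (simp_all add: slant_def twist_refl_def inner_prod_def)
    ultimately show False
      using assms(1) sqnorm_pos[OF \<open>((b, b), 0) \<in> ?S\<close>] by (simp add: angle_function_normal)
  qed
  moreover have "minimal_hypersurface (horizontal_section ?S t)" for t
    by (rule minimal_section)
  moreover have "shape_operator ?S (normal 1 c) p (gradient_on ?S snd p) \<bullet> gradient_on ?S snd p = 0" if p: "p \<in> ?S" for p
  proof -
    let ?g = "gradient_on ?S snd p"
    have "?g \<in> tangent_space ?S p"
      unfolding tangent_space_helicoid[OF p] gradient_on_snd[OF p] by (simp add: conormal_inner)
    then have "shape_operator ?S (normal 1 c) p ?g = - normal_deriv 1 c p ?g"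
      using shape_operator_eq[of p c UNIV 1 "normal 1 c" ?g] p sqnorm_pos[OF p] by simp
    moreover have "normal_deriv 1 c p ?g \<bullet> ?g = 0"
      by (rule normal_deriv_gradient[OF p gradient_on_snd[OF p]])
    ultimately show ?thesis by simp
  qed
  ultimately show ?thesis
    unfolding vertical_helicoid_def by blast
qed

section \<open>The spacelike part and its Lorentzian normal\<close>

lemma lorentz_normal_eq:
  assumes p: "p \<in> helicoid c" and pos: "sqnorm (-1) c p > 0"
  shows "lorentz_normal (normal 1 c) p = normal (-1) c p"
proof -
  let ?M = "sqnorm 1 c p" and ?m = "sqnorm (-1) c p" and ?\<Theta> = "angle_function (normal 1 c) p"
  have M: "?M > 0" using sqnorm_pos[OF p] .
  \<comment> \<open>The Lorentzian normalisation thus exchanges the factor for \<open>?M\<close>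
    with the one for \<open>?m\<close>.\<close>
  have "2 * ?\<Theta>\<^sup>2 - 1 = ?m / ?M"
    using M by (simp add: angle_function_normal_sq[OF p] field_simps) (simp add: sqnorm_def power_mult_distrib)
  moreover have "1 / sqrt (?m / ?M) * ?M powr (- 1 / 2) = ?m powr (- 1 / 2)"
    using M pos by (simp add: real_sqrt_divide powr_minus powr_half_sqrt field_simps)
  ultimately have "1 / sqrt (2 * ?\<Theta>\<^sup>2 - 1) * ?M powr (- 1 / 2) = ?m powr (- 1 / 2)" by (simp only:)
  \<comment> \<open>Subtracting twice the vertical part flips the sign of the height component,
    which is the change from \<open>\<epsilon> = 1\<close> to
    \<open>\<epsilon> = -1\<close>.\<close>
  moreover have "normal 1 c p - (2 * ?\<Theta>) *\<^sub>R vertical_field = (?M powr (- 1 / 2)) *\<^sub>R conormal (-1) c p"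
    by (simp add: angle_function_normal normal_def vertical_field_def conormal_def algebra_simps)
  ultimately show ?thesis
    unfolding lorentz_normal_def by (simp add: normal_def)
qed

lemma zero_mean_isocurved_helicoid:
  "zero_mean_isocurved (helicoid c \<inter> {p. sqnorm (-1) c p > 0})"
proof -
  let ?V = "{p. sqnorm (-1) c p > 0}"
  let ?W = "helicoid c \<inter> ?V"
  have V: "open ?V" by (rule open_sqnorm_pos)
  have "spacelike ?W"
    unfolding spacelike_def
  proof (intro ballI impI)
    fix p X assume p: "p \<in> ?W" and X: "X \<in> tangent_space ?W p" "X \<noteq> 0"
    define q u \<tau> w where "q = fst p" and "u = fst X" and "\<tau> = snd X" and "w = c * slant c p"
    have "w\<^sup>2 > q \<bullet> q" using p by (simp add: sqnorm_def w_def q_def)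
    have "u \<bullet> twist_refl (2 * c * snd p) q + w * \<tau> = 0"
      using X(1) unfolding tangent_space_helicoid_Int[OF p V] by (simp add: conormal_inner u_def q_def \<tau>_def w_def)
    \<comment> \<open>Cauchy-Schwarz bounds the height component of a tangent vector;
      \<open>w\<^sup>2 > q \<bullet> q\<close> then makes the bound strict once \<open>u\<close> is
      nonzero.\<close>
    then have "(w * \<tau>)\<^sup>2 = (u \<bullet> twist_refl (2 * c * snd p) q)\<^sup>2"
      by (metis add_eq_0_iff power2_minus)
    also have "\<dots> \<le> (u \<bullet> u) * (q \<bullet> q)"
      using Cauchy_Schwarz_ineq[of u "twist_refl (2 * c * snd p) q"] by simp
    finally have le: "w\<^sup>2 * \<tau>\<^sup>2 \<le> (u \<bullet> u) * (q \<bullet> q)" by (simp add: power_mult_distrib)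
    have w: "w\<^sup>2 > 0" using \<open>w\<^sup>2 > q \<bullet> q\<close> inner_ge_zero[of q] by linarith
    have "u \<noteq> 0"
    proof
      assume "u = 0"
      then have "w\<^sup>2 * \<tau>\<^sup>2 \<le> 0" using le by simp
      then have "\<tau> = 0" using w by (simp add: mult_le_0_iff)
      with \<open>u = 0\<close> X(2) show False by (simp add: u_def \<tau>_def prod_eq_iff)
    qed
    then have "(u \<bullet> u) * (q \<bullet> q) < (u \<bullet> u) * w\<^sup>2"
      using \<open>w\<^sup>2 > q \<bullet> q\<close> by simp
    with le have "w\<^sup>2 * \<tau>\<^sup>2 < w\<^sup>2 * (u \<bullet> u)" by (simp add: mult.commute)
    then have "\<tau>\<^sup>2 < u \<bullet> u" using w by simp
    then show "lorentz_product X X > 0"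
      by (simp add: lorentz_product_def u_def \<tau>_def power2_eq_square)
  qed
  moreover have "mean_curvature ?W (normal 1 c) p = 0" if "p \<in> ?W" for p
    unfolding mean_curvature_def using that sqnorm_pos[of p c] by (intro trace_shape_operator[OF V, where \<epsilon> = 1]) auto
  moreover have "lorentz_mean_curvature ?W (normal 1 c) p = 0" if "p \<in> ?W" for p
  proof -
    have "trace_on (tangent_space ?W p) (shape_operator ?W (lorentz_normal (normal 1 c)) p) = 0"
      using that by (intro trace_shape_operator[OF V, where \<epsilon> = "-1"]) (auto intro: lorentz_normal_eq)
    then show ?thesis by (simp add: lorentz_mean_curvature_def)
  qed
  ultimately show ?thesis
    unfolding zero_mean_isocurved_def
    using embedded_hypersurface_helicoid[OF V, of c] unit_normal_field_normal[OF V, of c] by blast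
qed

lemma spacelike_part_nonempty:
  assumes "c > 0"
  shows "helicoid c \<inter> {p :: (('a::euclidean_space \<times> 'a) \<times> real). sqnorm (-1) c p > 0} \<noteq> {}"
proof -
  obtain b :: 'a where b: "b \<in> Basis" using nonempty_Basis by blast
  \<comment> \<open>Among points \<open>((r b, r b), 0)\<close> the slant grows like the square of
    \<open>r\<close>. The radius \<open>1 / c\<close> is large enough and gives the value
    \<open>2 / c\<^sup>2\<close>.\<close>
  define p where "p = (((1 / c) *\<^sub>R b, (1 / c) *\<^sub>R b), 0 :: real)"
  have "b \<noteq> 0" "b \<bullet> b = 1" using b by auto
  then have "p \<in> helicoid c"
    using assms by (simp add: p_def helicoid_def twist_refl_def zero_prod_def inner_prod_def)
  moreover have "slant c p = 2 / c\<^sup>2" "fst p \<bullet> fst p = 2 / c\<^sup>2"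
    using \<open>b \<bullet> b = 1\<close> by (simp_all add: p_def slant_def twist_refl_def inner_prod_def power2_eq_square)
  then have "sqnorm (-1) c p = (c * (2 / c\<^sup>2))\<^sup>2 - 2 / c\<^sup>2" by (simp add: sqnorm_def)
  then have "sqnorm (-1) c p = 2 / c\<^sup>2"
    using assms by (simp add: power2_eq_square)
  ultimately show ?thesis using assms by auto
qed

theorem corollary3:
  fixes n :: nat
  assumes "n \<ge> 1" and "CARD('n::finite) = n + 1"
  shows "(\<forall>a>0. \<forall>k>0. vertical_helicoid (twisting a k :: (((real^'n) \<times> (real^'n)) \<times> real) set)) \<and>
         (\<forall>a>0. \<exists>k>0. \<exists>W. W \<noteq> {} \<and>
            openin (top_of_set (twisting a k :: (((real^'n) \<times> (real^'n)) \<times> real) set)) W \<and>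
            zero_mean_isocurved W)"
proof (intro conjI allI impI)
  fix a k :: real assume "a > 0" "k > 0"
  then show "vertical_helicoid (twisting a k :: (((real^'n) \<times> (real^'n)) \<times> real) set)"
    \<comment> \<open>The bound \<open>n + 1 \<ge> 2\<close> supplies the two orthonormal vectors
      for the nonconstant angle.\<close>
    using assms by (simp add: twisting_eq_helicoid vertical_helicoid_helicoid)
next
  fix a :: real assume "a > 0"
  \<comment> \<open>The witness is \<open>k = 1\<close>, so the helicoid has parameter
    \<open>1 / a\<close>.\<close>
  let ?S = "helicoid (1 / a) :: (((real^'n) \<times> (real^'n)) \<times> real) set"
  let ?W = "?S \<inter> {p. sqnorm (-1) (1 / a) p > 0}"
  have "?W \<noteq> {}" "openin (top_of_set ?S) ?W" "zero_mean_isocurved ?W"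
    using \<open>a > 0\<close> spacelike_part_nonempty[of "1 / a"] open_sqnorm_pos[of "-1" "1 / a"]
      zero_mean_isocurved_helicoid[of "1 / a"] openin_open_Int by auto
  moreover have "twisting a 1 = ?S" using \<open>a > 0\<close> by (simp add: twisting_eq_helicoid)
  ultimately show "\<exists>k>0. \<exists>W. W \<noteq> {} \<and>
      openin (top_of_set (twisting a k :: (((real^'n) \<times> (real^'n)) \<times> real) set)) W \<and> zero_mean_isocurved W"
    by (metis zero_less_one)
qed

end
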